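(* Consider the regression model $Y_n=f(X_n-\theta)+\varepsilon_n$, $n\ge0$, where $(X_n)$ and $(\varepsilon_n)$ are two independent sequences of independent and identically distributed random variables, $(\varepsilon_n)$ has zero mean and finite positive variance $\sigma^2$, and: (i) the $X_n$ have an unknown probability density function $g$, positive on its support $[-1/2,1/2]$, continuous, twice differentiable with bounded derivatives; (ii) the function $f$ is symmetric (even), bounded and periodic with period $1$. Let $f_1=\int_{-1/2}^{1/2}\cos(2\pi x)f(x)\,dx$ (assumed nonzero), let $C=[-1/4,1/4]$ and let $\pi_C$ be the projection onto $C$ ($\pi_C(x)=x$ if $|x|\le1/4$, $=1/4$ if $x\ge1/4$, $=-1/4$ if $x\le-1/4$). Let $K$ be a symmetric, positive, Lipschitz kernel with compact support, $\int K=1$, $\int K^2<\infty$, $\int x^2K(x)\,dx<\infty$, let $0<\alpha<1$, $h_n=n^{-\alpha}$, and $\widehat g_n(x)=\frac1n\sum_{i=1}^n h_i^{-1}K((X_i-x)/h_i)$. Let $\gamma_n=1/n$ and define, from an initial value $\widehat\theta_1\in C$, for $n\ge1$, $$\widehat\theta_{n+1}=\pi_C\Bigl(\widehat\theta_n+\mathrm{sign}(f_1)\gamma_{n+1}\widehat T_{n+1}\Bigr),\qquad \widehat T_{n+1}=\frac{\sin(2\pi(X_{n+1}-\widehat\theta_n))}{\widehat g_n(X_{n+1})}Y_{n+1}.$$ Assume $|\theta|<1/4$. Then $\widehat\theta_n$ converges almost surely to $\theta$. In addition, the number of indices $n$ for which $\widehat\theta_n+\mathrm{sign}(f_1)\gamma_{n+1}\widehat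 T_{n+1}\notin C$ is almost surely finite. *)

theory Defs
  imports "HOL-Probability.Probability"
begin

definition projC :: "real \<Rightarrow> real" where
  "projC x = (if \<bar>x\<bar> \<le> 1/4 then x else if x \<ge> 1/4 then 1/4 else -1/4)"

definition bw :: "real \<Rightarrow> nat \<Rightarrow> real" where
  "bw \<alpha> n = real n powr (- \<alpha>)"

definition ghat :: "(real \<Rightarrow> real) \<Rightarrow> real \<Rightarrow> (nat \<Rightarrow> 'a \<Rightarrow> real) \<Rightarrow> nat \<Rightarrow> real \<Rightarrow> 'a \<Rightarrow> real" where
  "ghat K \<alpha> X n x \<omega> =
     (1 / real n) * (\<Sum>i = 1..n. (1 / bw \<alpha> i) * K ((X i \<omega> - x) / bw \<alpha> i))"

definition Yreg :: "(real \<Rightarrow> real) \<Rightarrow> real \<Rightarrow> (nat \<Rightarrow> 'a \<Rightarrow> real) \<Rightarrow> (nat \<Rightarrow> 'a \<Rightarrow> real) \<Rightarrow> nat \<Rightarrow> 'a \<Rightarrow> real" where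
  "Yreg f \<theta> X eps n \<omega> = f (X n \<omega> - \<theta>) + eps n \<omega>"

definition fourier1 :: "(real \<Rightarrow> real) \<Rightarrow> real" where
  "fourier1 f = (LBINT x:{-1/2..1/2}. cos (2 * pi * x) * f x)"

text \<open>The estimator. thetahat n for n >= 1 is the paper's \<theta>-hat_n; the value at
  index 0 is a dummy (set to the initial value). Each step uses
  T_{n+1} = sin(2 pi (X_{n+1} - thetahat_n)) / ghat_n(X_{n+1}) * Y_{n+1} and gamma_{n+1} = 1/(n+1).\<close>
definition Tstat :: "(real \<Rightarrow> real) \<Rightarrow> real \<Rightarrow> (nat \<Rightarrow> 'a \<Rightarrow> real) \<Rightarrow> (nat \<Rightarrow> 'a \<Rightarrow> real)
    \<Rightarrow> nat \<Rightarrow> real \<Rightarrow> 'a \<Rightarrow> real" where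
  "Tstat K \<alpha> X Y n th \<omega> =
     sin (2 * pi * (X (Suc n) \<omega> - th)) / ghat K \<alpha> X n (X (Suc n) \<omega>) \<omega> * Y (Suc n) \<omega>"

primrec thetahat :: "(real \<Rightarrow> real) \<Rightarrow> real \<Rightarrow> real \<Rightarrow> (nat \<Rightarrow> 'a \<Rightarrow> real) \<Rightarrow> (nat \<Rightarrow> 'a \<Rightarrow> real)
    \<Rightarrow> real \<Rightarrow> nat \<Rightarrow> 'a \<Rightarrow> real" where
  "thetahat K \<alpha> s X Y th1 0 \<omega> = th1"
| "thetahat K \<alpha> s X Y th1 (Suc n) \<omega> =
     (if n = 0 then th1
      else projC (thetahat K \<alpha> s X Y th1 n \<omega>
             + s * (1 / real (Suc n)) * Tstat K \<alpha> X Y n (thetahat K \<alpha> s X Y th1 n \<omega>) \<omega>))"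

definition prestep :: "(real \<Rightarrow> real) \<Rightarrow> real \<Rightarrow> real \<Rightarrow> (nat \<Rightarrow> 'a \<Rightarrow> real) \<Rightarrow> (nat \<Rightarrow> 'a \<Rightarrow> real)
    \<Rightarrow> real \<Rightarrow> nat \<Rightarrow> 'a \<Rightarrow> real" where
  "prestep K \<alpha> s X Y th1 n \<omega> =
     thetahat K \<alpha> s X Y th1 n \<omega>
       + s * (1 / real (Suc n)) * Tstat K \<alpha> X Y n (thetahat K \<alpha> s X Y th1 n \<omega>) \<omega>"

end

theory Submission
  imports Defs
begin

text \<open>
  On average a step moves the estimate by \<open>\<gamma>\<^sub>n \<bar>f\<^sub>1\<bar> sin (2\<pi> (\<theta> - \<theta>\<^sub>n))\<close>, which points towards
  \<open>\<theta>\<close> throughout \<open>C\<close>, up to a bias caused by using the estimated density. A grid, the Lipschitz kernel and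
  a Chernoff bound of size \<open>exp (- C n\<^bsup>1-\<alpha>\<^esup>)\<close> show that the density estimate is almost surely
  bounded away from 0 on \<open>[-1/2,1/2]\<close> (at the end points it only sees half of the kernel mass) and
  converges pointwise in the interior, so the bias vanishes by dominated convergence. With the
  denominator floored at a positive constant, the weighted noise is a sequence of orthogonal variables
  with second moments \<open>O(1/n\<^sup>2)\<close>, so its series converges almost surely. It remains to see that a
  projected recursion on the line, with a vanishing bias and a convergent noise series, converges to the
  zero of its drift; as \<open>\<theta>\<close> is interior to \<open>C\<close>, the projection is then eventually inactive.
\<close>

text \<open>Several obstacles shape the proof. The step divides by \<open>ghat\<close>, which may be
  tiny or 0 for small n, so the raw noise need not be integrable; hence the floor. The constant
  \<open>c/8\<close> records three losses: half the kernel mass at an end point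
  (\<open>c/2\<close>), averaging over early indices (\<open>c/4\<close>), random fluctuation
  (\<open>c/8\<close>). The lower bound is used at the random point
  \<open>X (Suc n) \<omega>\<close>, and the limit inside an integral over x, so one null set must
  serve all x: this forces the grid. Uniform convergence to g on the closed interval cannot hold,
  since g jumps to 0 at its end points; a uniform lower bound and pointwise convergence inside are
  enough. The noise splits into two series because \<open>X (Suc n)\<close> and
  \<open>eps (Suc n)\<close> are averaged out against different pasts: the path up to n for the
  former, that path together with \<open>X (Suc n)\<close> for the latter. No conditional
  expectation appears; orthogonality comes from Fubini on the joint law of the past and the new
  coordinate. The noise series may converge only conditionally, so the recursion argument relies on
  its sums and never on the total size of its terms.\<close>

section \<open>Projected recursions on the line\<close>

text \<open>The noise enters only through the convergent \<open>S\<close>. The first alternative in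
  \<open>above\<close> covers clipping at the lower end of C, which can undo part of a step but only
  below c; \<open>below\<close> limits the jump out of the region under c.\<close>

lemma descent_eventually_le:
  fixes x \<gamma> S :: "nat \<Rightarrow> real"
  assumes S: "S \<longlonglongrightarrow> L" and eps: "0 < \<epsilon>" and eta: "0 < \<eta>"
    and gam: "\<And>n. 0 \<le> \<gamma> n" "\<not> summable \<gamma>" and bdd: "\<And>n. B \<le> x n"
    and above: "eventually (\<lambda>n. x n > c \<longrightarrow>
        x (Suc n) \<le> c \<or> x (Suc n) \<le> x n - \<eta> * \<gamma> n + (S (Suc n) - S n)) sequentially"
    and below: "eventually (\<lambda>n. x n \<le> c \<longrightarrow> x (Suc n) \<le> c + \<epsilon>) sequentially"
  shows "eventually (\<lambda>n. x n \<le> c + 4 * \<epsilon>) sequentially"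
proof -
  have "eventually (\<lambda>n. \<bar>S n - L\<bar> < \<epsilon>) sequentially"
    using tendstoD[OF S eps] by (simp add: dist_real_def)
  with above below have "eventually (\<lambda>n. (x n > c \<longrightarrow>
        x (Suc n) \<le> c \<or> x (Suc n) \<le> x n - \<eta> * \<gamma> n + (S (Suc n) - S n)) \<and>
        (x n \<le> c \<longrightarrow> x (Suc n) \<le> c + \<epsilon>) \<and> \<bar>S n - L\<bar> < \<epsilon>) sequentially"
    by eventually_elim auto
  then obtain N where N: "\<And>n. n \<ge> N \<Longrightarrow> x n > c \<Longrightarrow>
        x (Suc n) \<le> c \<or> x (Suc n) \<le> x n - \<eta> * \<gamma> n + (S (Suc n) - S n)"
      "\<And>n. n \<ge> N \<Longrightarrow> x n \<le> c \<Longrightarrow> x (Suc n) \<le> c + \<epsilon>" "\<And>n. n \<ge> N \<Longrightarrow> \<bar>S n - L\<bar> < \<epsilon>"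
    unfolding eventually_sequentially by blast
  \<comment> \<open>Adding the tail of the noise series makes the descent monotone.\<close>
  define y where "y n = x n + (L - S n)" for n
  \<comment> \<open>The level c + 3 \<epsilon> is absorbing for y: from N on, x and y differ by less
    than \<epsilon>, so a step from x \<le> c leaves y below c + 2 \<epsilon>, and a step from x > c
    either lands at most at c or does not increase y.\<close>
  have step: "y (Suc n) \<le> c + 3 * \<epsilon>" if "n \<ge> N" "y n \<le> c + 3 * \<epsilon>" for n
  proof (cases "x n \<le> c")
    case True
    then show ?thesis using N(2)[of n] N(3)[of "Suc n"] that eps by (auto simp: y_def)
  next
    case False
    have "0 \<le> \<eta> * \<gamma> n" using eta gam(1) by simp
    then show ?thesis using False N(1)[of n] N(3)[of "Suc n"] that eps by (auto simp: y_def)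
  qed
  \<comment> \<open>If y stayed above the level, x would stay above c and each step would lower y by
    \<open>\<eta> * \<gamma> n\<close>; the level itself then bounds the partial sums of \<gamma>,
    against their divergence.\<close>
  have "\<exists>n\<ge>N. y n \<le> c + 3 * \<epsilon>"
  proof (rule ccontr)
    assume "\<not> ?thesis"
    then have far: "y n > c + 3 * \<epsilon>" if "n \<ge> N" for n using that by force
    have dec: "y (Suc n) \<le> y n - \<eta> * \<gamma> n" if "n \<ge> N" for n
    proof -
      have "x n > c" "x (Suc n) > c"
        using far[of n] far[of "Suc n"] N(3)[of n] N(3)[of "Suc n"] that eps by (auto simp: y_def)
      then show ?thesis using N(1)[of n] that by (auto simp: y_def)
    qed
    have "\<eta> * (\<Sum>i<k. \<gamma> (i + N)) \<le> y N - y (N + k)" for k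
    proof (induction k)
      case (Suc k)
      then show ?case using dec[of "N + k"] by (simp add: algebra_simps)
    qed simp
    then have "(\<Sum>i<k. \<gamma> (i + N)) \<le> (y N - (c + 3 * \<epsilon>)) / \<eta>" for k
      using far[of "N + k"] eta by (simp add: pos_le_divide_eq mult.commute) (smt (verit))
    then have "summable (\<lambda>i. \<gamma> (i + N))"
      by (intro summableI_nonneg_bounded[where x="(y N - (c + 3 * \<epsilon>)) / \<eta>"]) (use gam in auto)
    then show False using gam(2) by (simp only: summable_iff_shift)
  qed
  then obtain n0 where n0: "n0 \<ge> N" "y n0 \<le> c + 3 * \<epsilon>" by blast
  have y: "y n \<le> c + 3 * \<epsilon>" if "n \<ge> n0" for n
    using that by (induction n rule: dec_induct) (use n0 step in auto)
  have "x n \<le> c + 4 * \<epsilon>" if "n \<ge> n0" for n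
    using y[OF that] N(3)[of n] that n0(1) by (auto simp: y_def)
  then show ?thesis unfolding eventually_sequentially by blast
qed

lemma projC_le: "-1/4 \<le> c \<Longrightarrow> p \<le> c \<Longrightarrow> projC p \<le> c"
  and projC_upper: "projC p \<le> max (-1/4) p"
  and projC_range: "projC p \<in> {-1/4..1/4}"
  and projC_minus: "projC (- p) = - projC p"
  by (auto simp: projC_def)

text \<open>As \<open>x n\<close> is at most 1/4 and \<theta> exceeds -1/4 + e, the gap
  \<open>x n - \<theta>\<close> above \<theta> + e lies in [e, 1/2 - e], where the sine is bounded
  below. Projection onto C thus keeps the recursion away from the other zero of the drift, at
  distance 1/2 from \<theta>.\<close>

lemma projected_recursion_upper:
  fixes x \<gamma> S r :: "nat \<Rightarrow> real"
  assumes S: "S \<longlonglongrightarrow> L" and gam: "\<And>n. 0 \<le> \<gamma> n" "\<not> summable \<gamma>" "\<gamma> \<longlonglongrightarrow> 0"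
    and r: "r \<longlonglongrightarrow> 0" and a: "0 < a" and \<theta>: "\<bar>\<theta>\<bar> < 1/4"
    and range: "\<And>n. x n \<in> {-1/4..1/4}"
    and rec: "eventually (\<lambda>n. x (Suc n) = projC (x n + \<gamma> n * (a * sin (2 * pi * (\<theta> - x n)) + r n)
                 + (S (Suc n) - S n))) sequentially"
    and e: "0 < e" "e < 1/4 - \<bar>\<theta>\<bar>"
  shows "eventually (\<lambda>n. x n \<le> \<theta> + 5 * e) sequentially"
proof -
  \<comment> \<open>Half of the weakest pull \<open>a * sin (2 * pi * e)\<close>; the other half
    absorbs the bias r.\<close>
  define \<eta> where "\<eta> = a * sin (2 * pi * e) / 2"
  have e2: "e < 1/4" using e \<theta> by linarith
  have "0 < sin (2 * pi * e)" using e e2 by (intro sin_gt_zero) auto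
  then have eta: "0 < \<eta>" using a by (simp add: \<eta>_def)
  \<comment> \<open>The sine increases up to t = 1/4; beyond, the reflection t to 1/2 - t returns to
    that range.\<close>
  have sin_ge: "sin (2 * pi * e) \<le> sin (2 * pi * t)" if "e \<le> t" "t \<le> 1/2 - e" for t
  proof (cases "t \<le> 1/4")
    case True
    have "2 * pi * e \<le> 2 * pi * t" using that by simp
    moreover have "2 * pi * t \<le> pi / 2" using True by simp
    moreover have "- (pi / 2) \<le> 2 * pi * e"
      using e by (smt (verit, ccfv_SIG) mult_nonneg_nonneg pi_gt_zero divide_nonneg_nonneg)
    ultimately show ?thesis by (intro sin_monotone_2pi_le) auto
  next
    case False
    have "sin (2 * pi * e) \<le> sin (2 * pi * (1/2 - t))"
    proof (intro sin_monotone_2pi_le)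
      have "2 * pi * (1/2 - t) \<le> 2 * pi * (1/4)" using False by (intro mult_left_mono) auto
      then show "2 * pi * (1/2 - t) \<le> pi / 2" by simp
      show "- (pi / 2) \<le> 2 * pi * e" using e by (smt (verit, ccfv_SIG) mult_nonneg_nonneg pi_gt_zero divide_nonneg_nonneg)
      show "2 * pi * e \<le> 2 * pi * (1/2 - t)" using that by (intro mult_left_mono) auto
    qed
    also have "2 * pi * (1/2 - t) = pi - 2 * pi * t" by (simp add: algebra_simps)
    finally show ?thesis by simp
  qed
  have dS: "(\<lambda>n. S (Suc n) - S n) \<longlonglongrightarrow> 0"
    using tendsto_diff[OF LIMSEQ_Suc[OF S] S] by simp
  have ev_r: "eventually (\<lambda>n. \<bar>r n\<bar> < \<eta>) sequentially"
    using tendstoD[OF r eta] by simp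
  \<comment> \<open>Bounds the upward move of a single step before projection once |r n| <
    \<eta>.\<close>
  have "(\<lambda>n. \<gamma> n * (a + \<eta>) + \<bar>S (Suc n) - S n\<bar>) \<longlonglongrightarrow> 0 * (a + \<eta>) + \<bar>0\<bar>"
    by (intro tendsto_intros gam dS)
  then have ev_small: "eventually (\<lambda>n. \<gamma> n * (a + \<eta>) + \<bar>S (Suc n) - S n\<bar> < e) sequentially"
    using e by (intro order_tendstoD) auto
  have "eventually (\<lambda>n. x n \<le> (\<theta> + e) + 4 * e) sequentially"
  proof (rule descent_eventually_le[OF S e(1) eta gam(1,2)])
    show "-1/4 \<le> x n" for n using range[of n] by simp
    show "eventually (\<lambda>n. x n > \<theta> + e \<longrightarrow> x (Suc n) \<le> \<theta> + e \<or>
       x (Suc n) \<le> x n - \<eta> * \<gamma> n + (S (Suc n) - S n)) sequentially"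
      using rec ev_r
    proof eventually_elim
      case (elim n)
      show ?case
      proof
        assume "x n > \<theta> + e"
        moreover have "x n - \<theta> \<le> 1/2 - e" using range[of n] e by auto
        ultimately have "sin (2 * pi * e) \<le> sin (2 * pi * (x n - \<theta>))" by (intro sin_ge) auto
        moreover have "sin (2 * pi * (x n - \<theta>)) = - sin (2 * pi * (\<theta> - x n))"
          by (simp add: sin_minus[symmetric] algebra_simps)
        ultimately have "a * sin (2 * pi * (\<theta> - x n)) \<le> a * (- sin (2 * pi * e))"
          using a by (intro mult_left_mono) auto
        then have "a * sin (2 * pi * (\<theta> - x n)) + r n \<le> - \<eta>"
          using elim(2) by (auto simp: \<eta>_def)
        then have "\<gamma> n * (a * sin (2 * pi * (\<theta> - x n)) + r n) \<le> \<gamma> n * (- \<eta>)"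
          using gam(1) by (rule mult_left_mono)
        then show "x (Suc n) \<le> \<theta> + e \<or> x (Suc n) \<le> x n - \<eta> * \<gamma> n + (S (Suc n) - S n)"
          using elim(1) projC_upper[of "x n + \<gamma> n * (a * sin (2 * pi * (\<theta> - x n)) + r n)
                 + (S (Suc n) - S n)"] \<theta> e by (auto simp: algebra_simps)
      qed
    qed
    show "eventually (\<lambda>n. x n \<le> \<theta> + e \<longrightarrow> x (Suc n) \<le> \<theta> + e + e) sequentially"
      using rec ev_r ev_small
    proof eventually_elim
      case (elim n)
      have "a * sin (2 * pi * (\<theta> - x n)) \<le> a * 1" using a by (intro mult_left_mono) auto
      then have "\<gamma> n * (a * sin (2 * pi * (\<theta> - x n)) + r n) \<le> \<gamma> n * (a + \<eta>)"
        using gam(1) elim(2) by (intro mult_left_mono) auto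
      then show ?case using elim(1,3) \<theta> e
        by (auto intro!: projC_le)
    qed
  qed
  then show ?thesis by (simp add: algebra_simps)
qed

text \<open>The lower bound is the upper bound for the reflected recursion: \<open>projC\<close> and
  the sine are odd, so -x, -\<theta>, -S and -r satisfy the same hypotheses.\<close>

lemma projected_recursion_tendsto:
  fixes x \<gamma> S r :: "nat \<Rightarrow> real"
  assumes S: "S \<longlonglongrightarrow> L" and gam: "\<And>n. 0 \<le> \<gamma> n" "\<not> summable \<gamma>" "\<gamma> \<longlonglongrightarrow> 0"
    and r: "r \<longlonglongrightarrow> 0" and a: "0 < a" and \<theta>: "\<bar>\<theta>\<bar> < 1/4"
    and range: "\<And>n. x n \<in> {-1/4..1/4}"
    and rec: "eventually (\<lambda>n. x (Suc n) = projC (x n + \<gamma> n * (a * sin (2 * pi * (\<theta> - x n)) + r n)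
                 + (S (Suc n) - S n))) sequentially"
  shows "x \<longlonglongrightarrow> \<theta>"
proof (rule tendstoI)
  fix \<epsilon> :: real assume "0 < \<epsilon>"
  define e where "e = min (\<epsilon> / 6) ((1/4 - \<bar>\<theta>\<bar>) / 2)"
  have e: "0 < e" "e < 1/4 - \<bar>\<theta>\<bar>" "5 * e < \<epsilon>" using \<open>0 < \<epsilon>\<close> \<theta> by (auto simp: e_def min_def)
  have up: "eventually (\<lambda>n. x n \<le> \<theta> + 5 * e) sequentially"
    by (rule projected_recursion_upper[OF S gam r a \<theta> range rec e(1,2)])
  have "eventually (\<lambda>n. - x n \<le> - \<theta> + 5 * e) sequentially"
  proof (rule projected_recursion_upper[where S="\<lambda>n. - S n" and L="- L" and \<gamma>=\<gamma> and r="\<lambda>n. - r n" and a=a])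
    show "eventually (\<lambda>n. - x (Suc n) = projC (- x n + \<gamma> n * (a * sin (2 * pi * (- \<theta> - - x n)) + - r n)
                 + (- S (Suc n) - - S n))) sequentially"
      using rec
    proof eventually_elim
      case (elim n)
      have "sin (2 * pi * (- \<theta> - - x n)) = - sin (2 * pi * (\<theta> - x n))"
        by (simp add: sin_minus[symmetric] algebra_simps)
      then show ?case using elim by (simp add: projC_minus[symmetric] algebra_simps)
    qed
    show "(\<lambda>n. - r n) \<longlonglongrightarrow> 0" using tendsto_minus[OF r] by simp
    show "- x n \<in> {-1/4..1/4}" for n using range[of n] by auto
  qed (use S gam r a \<theta> e in \<open>auto intro: tendsto_minus\<close>)
  with up show "eventually (\<lambda>n. dist (x n) \<theta> < \<epsilon>) sequentially"
    by eventually_elim (use e(3) in \<open>auto simp: dist_real_def\<close>)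
qed

section \<open>Fourier coefficients of even periodic functions\<close>

lemma integrable_interval_bounded:
  fixes \<phi> :: "real \<Rightarrow> real"
  assumes [measurable]: "\<phi> \<in> borel_measurable borel" "A \<in> sets borel"
    and A: "A \<subseteq> {a..b}" and B: "\<And>x. \<bar>\<phi> x\<bar> \<le> B"
  shows "integrable lborel (\<lambda>x. indicator A x * \<phi> x)"
proof (rule Bochner_Integration.integrable_bound[where f="\<lambda>x. indicator {a..b} x * B"])
  show "integrable lborel (\<lambda>x. indicator {a..b} x * B)"
    by (intro integrable_mult_left integrable_real_indicator) (auto simp: emeasure_lborel_Icc_eq)
  have "\<bar>indicator A x * \<phi> x\<bar> \<le> \<bar>indicator {a..b} x * B\<bar>" for x
    using A B[of x] by (auto simp: indicator_def)
  then show "AE x in lborel. norm (indicator A x * \<phi> x) \<le> norm (indicator {a..b} x * B)"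
    by simp
qed simp

text \<open>The translated interval is cut at -1/2 and the piece to the left is moved back by one
  period.\<close>

lemma integral_periodic_shift:
  fixes \<phi> :: "real \<Rightarrow> real"
  assumes [measurable]: "\<phi> \<in> borel_measurable borel"
    and bdd: "\<And>x. \<bar>\<phi> x\<bar> \<le> B" and per: "\<And>x. \<phi> (x + 1) = \<phi> x" and t: "-1 \<le> t" "t \<le> 1"
  shows "(LBINT x:{-1/2..1/2}. \<phi> (x - t)) = (LBINT x:{-1/2..1/2}. \<phi> x)"
proof -
  \<comment> \<open>Half-open intervals tile without overlap; dropping one end point changes only a
    null set.\<close>
  have half_open: "(LBINT x:{-1/2..1/2}. \<psi> x) = (\<integral>x. indicator {-1/2..<1/2} x * \<psi> x \<partial>lborel)"
    if [measurable]: "\<psi> \<in> borel_measurable borel" for \<psi> :: "real \<Rightarrow> real"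
  proof -
    have "AE x in lborel. x \<noteq> (1/2 :: real)" by (rule AE_lborel_singleton)
    then show ?thesis unfolding set_lebesgue_integral_def
      by (intro integral_cong_AE) (auto elim!: eventually_mono simp: indicator_def)
  qed
  have main: "(LBINT x:{-1/2..1/2}. \<phi> (x - t)) = (LBINT x:{-1/2..1/2}. \<phi> x)"
    if t: "0 \<le> t" "t \<le> 1" for t
  proof -
    have int: "integrable lborel (\<lambda>x. indicator {a..<b} x * \<phi> x)" for a b
      by (rule integrable_interval_bounded[where a=a and b=b and B=B]) (use bdd in auto)
    have "(LBINT x:{-1/2..1/2}. \<phi> (x - t)) = (\<integral>x. indicator {-1/2..<1/2} x * \<phi> (x - t) \<partial>lborel)"
      by (rule half_open) simp
    also have "\<dots> = (\<integral>x. indicator {-1/2..<1/2} (t + 1 * x) * \<phi> (t + 1 * x - t) \<partial>lborel)"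
      by (subst lborel_integral_real_affine[where c=1 and t=t]) simp_all
    also have "\<dots> = (\<integral>x. indicator {-1/2-t..<-1/2} x * \<phi> x + indicator {-1/2..<1/2-t} x * \<phi> x \<partial>lborel)"
      using t by (intro Bochner_Integration.integral_cong) (auto simp: indicator_def)
    also have "\<dots> = (\<integral>x. indicator {-1/2-t..<-1/2} x * \<phi> x \<partial>lborel)
                 + (\<integral>x. indicator {-1/2..<1/2-t} x * \<phi> x \<partial>lborel)"
      by (intro Bochner_Integration.integral_add int)
    also have "(\<integral>x. indicator {-1/2-t..<-1/2} x * \<phi> x \<partial>lborel)
             = (\<integral>x. indicator {-1/2-t..<-1/2} (-1 + 1 * x) * \<phi> (-1 + 1 * x) \<partial>lborel)"
      by (subst lborel_integral_real_affine[where c=1 and t="-1"]) simp_all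
    also have "\<dots> = (\<integral>x. indicator {1/2-t..<1/2} x * \<phi> x \<partial>lborel)"
    proof (intro Bochner_Integration.integral_cong refl)
      fix x show "indicator {-1/2-t..<-1/2} (-1 + 1 * x) * \<phi> (-1 + 1 * x) = indicator {1/2-t..<1/2} x * \<phi> x"
        using per[of "x - 1"] by (auto simp: indicator_def)
    qed
    also have "\<dots> + (\<integral>x. indicator {-1/2..<1/2-t} x * \<phi> x \<partial>lborel)
             = (\<integral>x. indicator {1/2-t..<1/2} x * \<phi> x + indicator {-1/2..<1/2-t} x * \<phi> x \<partial>lborel)"
      by (intro Bochner_Integration.integral_add[symmetric] int)
    also have "\<dots> = (\<integral>x. indicator {-1/2..<1/2} x * \<phi> x \<partial>lborel)"
      using t by (intro Bochner_Integration.integral_cong) (auto simp: indicator_def)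
    also have "\<dots> = (LBINT x:{-1/2..1/2}. \<phi> x)" by (rule half_open[symmetric]) simp
    finally show ?thesis .
  qed
  show ?thesis
  proof (cases "0 \<le> t")
    case False
    \<comment> \<open>A negative t is replaced by t + 1, which lies in [0,1].\<close>
    have "\<phi> (x - t) = \<phi> (x - (t + 1))" for x using per[of "x - (t + 1)"] by simp
    then show ?thesis using main[of "t + 1"] False t by simp
  qed (use main t in auto)
qed

text \<open>This is the reason for dividing by the density: without g, the mean step is a pure sine
  in \<theta> - u. After the shift by \<theta>, the addition formula leaves a cosine and a sine
  coefficient of f, and evenness kills the latter.\<close>

lemma fourier1_sin_convolution:
  assumes [measurable]: "f \<in> borel_measurable borel"
    and bdd: "\<And>x. \<bar>f x\<bar> \<le> B" and even: "\<And>x. f (- x) = f x" and per: "\<And>x. f (x + 1) = f x"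
    and \<theta>: "\<bar>\<theta>\<bar> \<le> 1"
  shows "(LBINT x:{-1/2..1/2}. sin (2 * pi * (x - u)) * f (x - \<theta>)) = fourier1 f * sin (2 * pi * (\<theta> - u))"
proof -
  define c where "c = 2 * pi * (\<theta> - u)"
  have B: "0 \<le> B" using bdd[of 0] by linarith
  have ub: "\<bar>s * f x\<bar> \<le> B" if "\<bar>s\<bar> \<le> 1" for s x
    using mult_mono[OF that bdd[of x]] by (simp add: abs_mult)
  have int: "integrable lborel (\<lambda>x. indicator {-1/2..1/2} x * (s x * f x))"
    if [measurable]: "s \<in> borel_measurable borel" and "\<And>x. \<bar>s x\<bar> \<le> 1" for s
    by (rule integrable_interval_bounded[where a="-1/2" and b="1/2" and B=B]) (use ub that in auto)
  have "sin (2 * pi * (x - u)) * f (x - \<theta>) = sin (2 * pi * (x - \<theta>) + c) * f (x - \<theta>)" for x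
    by (simp add: c_def algebra_simps)
  then have "(LBINT x:{-1/2..1/2}. sin (2 * pi * (x - u)) * f (x - \<theta>))
      = (LBINT x:{-1/2..1/2}. (\<lambda>y. sin (2 * pi * y + c) * f y) (x - \<theta>))" by (simp only:)
  also have "\<dots> = (LBINT y:{-1/2..1/2}. sin (2 * pi * y + c) * f y)"
  proof (rule integral_periodic_shift[where B=B])
    show "\<bar>sin (2 * pi * x + c) * f x\<bar> \<le> B" for x by (rule ub) simp
    fix x
    have "sin (2 * pi * (x + 1) + c) = sin ((2 * pi * x + c) + 2 * pi)" by (simp add: algebra_simps)
    then show "sin (2 * pi * (x + 1) + c) * f (x + 1) = sin (2 * pi * x + c) * f x"
      using per by simp
  qed (use \<theta> in auto)
  also have "\<dots> = (\<integral>y. cos c * (indicator {-1/2..1/2} y * (sin (2 * pi * y) * f y))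
                     + sin c * (indicator {-1/2..1/2} y * (cos (2 * pi * y) * f y)) \<partial>lborel)"
    unfolding set_lebesgue_integral_def
    by (intro Bochner_Integration.integral_cong) (auto simp: sin_add algebra_simps)
  also have "\<dots> = cos c * (\<integral>y. indicator {-1/2..1/2} y * (sin (2 * pi * y) * f y) \<partial>lborel)
                 + sin c * (\<integral>y. indicator {-1/2..1/2} y * (cos (2 * pi * y) * f y) \<partial>lborel)"
    by (subst Bochner_Integration.integral_add)
       ((intro integrable_mult_right int; simp)+, simp only: Bochner_Integration.integral_mult_right_zero)
  also have "(\<integral>y. indicator {-1/2..1/2} y * (cos (2 * pi * y) * f y) \<partial>lborel) = fourier1 f"
    by (simp add: fourier1_def set_lebesgue_integral_def)
  also have "(\<integral>y. indicator {-1/2..1/2} y * (sin (2 * pi * y) * f y) \<partial>lborel) = 0" (is "?I = 0")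
  proof -
    have "?I = (\<integral>y. indicator {-1/2..1/2} (0 + (-1) * y) * (sin (2 * pi * (0 + (-1) * y)) * f (0 + (-1) * y)) \<partial>lborel)"
      by (subst lborel_integral_real_affine[where c="-1" and t=0]) simp_all
    also have "\<dots> = (\<integral>y. - (indicator {-1/2..1/2} y * (sin (2 * pi * y) * f y)) \<partial>lborel)"
      using even by (intro Bochner_Integration.integral_cong) (auto simp: indicator_def)
    also have "\<dots> = - ?I" by simp
    finally show ?thesis by simp
  qed
  finally show ?thesis by (simp add: c_def)
qed

section \<open>Series of orthogonal random variables\<close>

text \<open>By Tonelli the sum of the series has finite expectation, hence is finite almost
  everywhere.\<close>

lemma (in prob_space) AE_summable_of_expectation:
  fixes Q :: "nat \<Rightarrow> 'a \<Rightarrow> real"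
  assumes int: "\<And>j. integrable M (Q j)" and nn: "\<And>j \<omega>. 0 \<le> Q j \<omega>"
    and le: "\<And>j. expectation (Q j) \<le> b j" and b: "summable b"
  shows "AE \<omega> in M. summable (\<lambda>j. Q j \<omega>)"
proof -
  have [measurable]: "Q j \<in> borel_measurable M" for j using int by auto
  have b0: "0 \<le> b j" for j using order_trans[OF Bochner_Integration.integral_nonneg le[of j]] nn by simp
  have "(\<integral>\<^sup>+\<omega>. (\<Sum>j. ennreal (Q j \<omega>)) \<partial>M) = (\<Sum>j. \<integral>\<^sup>+\<omega>. ennreal (Q j \<omega>) \<partial>M)"
    by (intro nn_integral_suminf) simp
  also have "\<dots> = (\<Sum>j. ennreal (expectation (Q j)))"
    using int nn by (intro suminf_cong nn_integral_eq_integral) auto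
  also have "\<dots> \<le> (\<Sum>j. ennreal (b j))"
    using le by (intro suminf_le ennreal_leI) auto
  also have "\<dots> < \<infinity>" using b b0 by (simp add: suminf_ennreal2)
  finally have "AE \<omega> in M. (\<Sum>j. ennreal (Q j \<omega>)) \<noteq> \<infinity>"
    by (intro nn_integral_PInf_AE) auto
  then show ?thesis
    by eventually_elim (use nn in \<open>auto intro: summable_suminf_not_top\<close>)
qed

lemma abs_mult_le_sum_squares: "\<bar>x * y\<bar> \<le> x\<^sup>2 + y\<^sup>2" for x y :: real
proof -
  have "2 * (\<bar>x\<bar> * \<bar>y\<bar>) \<le> x\<^sup>2 + y\<^sup>2"
    using zero_le_power2[of "\<bar>x\<bar> - \<bar>y\<bar>"] by (simp add: power2_diff)
  moreover have "0 \<le> \<bar>x\<bar> * \<bar>y\<bar>" by simp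
  ultimately show ?thesis unfolding abs_mult by linarith
qed

lemma (in prob_space) orthogonal_sum_second_moment:
  fixes D :: "'i \<Rightarrow> 'a \<Rightarrow> real"
  assumes fin: "finite A" and [measurable]: "\<And>i. D i \<in> borel_measurable M"
    and sq: "\<And>i. integrable M (\<lambda>\<omega>. (D i \<omega>)\<^sup>2)"
    and orth: "\<And>i j. i \<noteq> j \<Longrightarrow> expectation (\<lambda>\<omega>. D i \<omega> * D j \<omega>) = 0"
  shows "integrable M (\<lambda>\<omega>. (\<Sum>i\<in>A. D i \<omega>)\<^sup>2)"
    and "expectation (\<lambda>\<omega>. (\<Sum>i\<in>A. D i \<omega>)\<^sup>2) = (\<Sum>i\<in>A. expectation (\<lambda>\<omega>. (D i \<omega>)\<^sup>2))"
proof -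
  have prod: "integrable M (\<lambda>\<omega>. D i \<omega> * D j \<omega>)" for i j
  proof (rule Bochner_Integration.integrable_bound[where f="\<lambda>\<omega>. (D i \<omega>)\<^sup>2 + (D j \<omega>)\<^sup>2"])
    show "AE \<omega> in M. norm (D i \<omega> * D j \<omega>) \<le> norm ((D i \<omega>)\<^sup>2 + (D j \<omega>)\<^sup>2)"
      using abs_mult_le_sum_squares by auto
  qed (use sq in auto)
  have eq: "(\<Sum>i\<in>A. D i \<omega>)\<^sup>2 = (\<Sum>i\<in>A. \<Sum>j\<in>A. D i \<omega> * D j \<omega>)" for \<omega>
    by (simp add: power2_eq_square sum_product)
  show "integrable M (\<lambda>\<omega>. (\<Sum>i\<in>A. D i \<omega>)\<^sup>2)"
    unfolding eq by (intro Bochner_Integration.integrable_sum prod)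
  have "expectation (\<lambda>\<omega>. (\<Sum>i\<in>A. D i \<omega>)\<^sup>2) = (\<Sum>i\<in>A. \<Sum>j\<in>A. expectation (\<lambda>\<omega>. D i \<omega> * D j \<omega>))"
    unfolding eq by (simp add: Bochner_Integration.integral_sum prod)
  also have "\<dots> = (\<Sum>i\<in>A. expectation (\<lambda>\<omega>. D i \<omega> * D i \<omega>))"
  proof (intro sum.cong refl)
    fix i assume "i \<in> A"
    have "(\<Sum>j\<in>A. expectation (\<lambda>\<omega>. D i \<omega> * D j \<omega>)) =
       (\<Sum>j\<in>A. if j = i then expectation (\<lambda>\<omega>. D i \<omega> * D i \<omega>) else 0)"
      using orth by (intro sum.cong) auto
    also have "\<dots> = expectation (\<lambda>\<omega>. D i \<omega> * D i \<omega>)" using fin \<open>i \<in> A\<close> by simp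
    finally show "(\<Sum>j\<in>A. expectation (\<lambda>\<omega>. D i \<omega> * D j \<omega>)) = expectation (\<lambda>\<omega>. D i \<omega> * D i \<omega>)" .
  qed
  finally show "expectation (\<lambda>\<omega>. (\<Sum>i\<in>A. D i \<omega>)\<^sup>2) = (\<Sum>i\<in>A. expectation (\<lambda>\<omega>. (D i \<omega>)\<^sup>2))"
    by (simp add: power2_eq_square)
qed

text \<open>The deterministic half of the series argument: \<open>outer\<close> makes the values at
  cubes converge, \<open>inner\<close> controls the indices in between. Both are bounds on squares,
  the form in which second moments deliver them.\<close>

lemma convergent_of_cubic_blocks:
  fixes S Q :: "nat \<Rightarrow> real"
  assumes Q: "summable Q"
    and inner: "\<And>j k. 1 \<le> j \<Longrightarrow> j^3 \<le> k \<Longrightarrow> k \<le> (Suc j)^3 \<Longrightarrow> (S k - S (j^3))\<^sup>2 \<le> Q j"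
    and outer: "\<And>j. 1 \<le> j \<Longrightarrow> (real j * (S ((Suc j)^3) - S (j^3)))\<^sup>2 \<le> Q j"
  shows "convergent S"
proof -
  define T where "T j = S (j^3)" for j
  have "summable (\<lambda>j. T (Suc j) - T j)"
  proof (rule summable_comparison_test')
    show "summable (\<lambda>j. inverse (real j ^ 2) + Q j)"
      using Q inverse_power_summable[of 2, where 'a=real] by (intro summable_add) auto
    fix j :: nat assume j: "1 \<le> j"
    have halve: "x \<le> y" if "2 * x \<le> y" "0 \<le> x" for x y :: real using that by linarith
    have "inverse (real j) * (real j * d) = d" for d using j by (simp add: field_simps)
    \<comment> \<open>AM-GM for 1/j and j times the increment. This is the purpose of the weight j
      in \<open>outer\<close>: \<open>Q\<close> controls squares, whereas the increments themselves
      must be summable.\<close>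
    then have "2 * \<bar>T (Suc j) - T j\<bar> = 2 * \<bar>inverse (real j) * (real j * (T (Suc j) - T j))\<bar>"
      by (simp only:)
    also have "\<dots> \<le> (inverse (real j))\<^sup>2 + (real j * (T (Suc j) - T j))\<^sup>2"
    proof -
      have "2 * \<bar>a * b\<bar> \<le> a\<^sup>2 + b\<^sup>2" for a b :: real
        using zero_le_power2[of "\<bar>a\<bar> - \<bar>b\<bar>"] unfolding power2_diff abs_mult by simp
      then show ?thesis .
    qed
    also have "\<dots> \<le> inverse (real j ^ 2) + Q j"
      using outer[OF j] by (simp add: T_def power_inverse)
    finally show "norm (T (Suc j) - T j) \<le> inverse (real j ^ 2) + Q j"
      unfolding real_norm_def by (rule halve[OF _ abs_ge_zero])
  qed
  then have "convergent (\<lambda>n. \<Sum>j<n. T (Suc j) - T j)" by (simp add: summable_iff_convergent)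
  then have "convergent (\<lambda>n. T n - T 0)" by (simp add: sum_lessThan_telescope)
  then have "convergent (\<lambda>n. (T n - T 0) + T 0)" by (intro convergent_add convergent_const)
  then obtain L where L: "T \<longlonglongrightarrow> L" by (auto simp: convergent_def)
  have Q0: "Q \<longlonglongrightarrow> 0" by (rule summable_LIMSEQ_zero[OF Q])
  have "S \<longlonglongrightarrow> L"
  proof (rule LIMSEQ_I)
    fix \<epsilon> :: real assume e: "0 < \<epsilon>"
    have "eventually (\<lambda>j. \<bar>T j - L\<bar> < \<epsilon>/2) sequentially"
      using tendstoD[OF L, of "\<epsilon>/2"] e by (simp add: dist_real_def)
    moreover have "eventually (\<lambda>j. Q j < (\<epsilon>/2)\<^sup>2) sequentially"
      using e by (intro order_tendstoD(2)[OF Q0]) auto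
    ultimately have "eventually (\<lambda>j. \<bar>T j - L\<bar> < \<epsilon>/2 \<and> Q j < (\<epsilon>/2)\<^sup>2) sequentially"
      by eventually_elim auto
    then obtain J where J: "\<And>j. j \<ge> J \<Longrightarrow> \<bar>T j - L\<bar> < \<epsilon>/2 \<and> Q j < (\<epsilon>/2)\<^sup>2"
      unfolding eventually_sequentially by blast
    have "norm (S k - L) < \<epsilon>" if k: "k \<ge> (Suc J)^3" for k
    proof -
      have ex: "k < (Suc k)^3" by (simp add: power3_eq_cube)
      \<comment> \<open>The block containing k: \<open>j^3 \<le> k < (Suc j)^3\<close>.\<close>
      define j where "j = (LEAST j. k < (Suc j)^3)"
      have j1: "k < (Suc j)^3" unfolding j_def by (rule LeastI[of _ k]) (rule ex)
      have jJ: "j \<ge> Suc J"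
      proof (rule ccontr)
        assume "\<not> ?thesis"
        then have "(Suc j)^3 \<le> (Suc J)^3" by (intro power_mono) auto
        then show False using j1 k by linarith
      qed
      then obtain i where i: "j = Suc i" by (cases j) auto
      have "\<not> k < (Suc i)^3" using not_less_Least[of i "\<lambda>j. k < (Suc j)^3"] i j_def by auto
      then have "j^3 \<le> k" using i by simp
      then have "(S k - T j)\<^sup>2 \<le> Q j" using inner[of j k] j1 jJ by (simp add: T_def)
      also have "\<dots> < (\<epsilon>/2)\<^sup>2" using J jJ by simp
      finally have "\<bar>S k - T j\<bar>\<^sup>2 < (\<epsilon>/2)\<^sup>2" by (simp only: power2_abs)
      then have "\<bar>S k - T j\<bar> < \<epsilon>/2" 
        by (rule power2_less_imp_less) (use e in simp)
      moreover have "\<bar>T j - L\<bar> < \<epsilon>/2" using J[OF Suc_leD[OF jJ]] by (rule conjunct1)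
      ultimately show ?thesis unfolding real_norm_def by linarith
    qed
    then show "\<exists>no. \<forall>k\<ge>no. norm (S k - L) < \<epsilon>" by blast
  qed
  then show ?thesis by (auto simp: convergent_def)
qed

text \<open>Because the second moments decay like \<open>1/n\<^sup>2\<close>, a union bound over the indices between
  consecutive cubes replaces the maximal inequality.\<close>
lemma (in prob_space) orthogonal_series_AE_convergent:
  fixes D :: "nat \<Rightarrow> 'a \<Rightarrow> real"
  assumes meas[measurable]: "\<And>i. D i \<in> borel_measurable M"
    and sq: "\<And>i. integrable M (\<lambda>\<omega>. (D i \<omega>)\<^sup>2)"
    and le: "\<And>i. expectation (\<lambda>\<omega>. (D i \<omega>)\<^sup>2) \<le> C / (real (Suc i))\<^sup>2"
    and orth: "\<And>i j. i < j \<Longrightarrow> expectation (\<lambda>\<omega>. D i \<omega> * D j \<omega>) = 0"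
  shows "AE \<omega> in M. convergent (\<lambda>n. \<Sum>i<n. D i \<omega>)"
proof -
  define S where "S \<omega> n = (\<Sum>i<n. D i \<omega>)" for \<omega> n
  have orth': "expectation (\<lambda>\<omega>. D i \<omega> * D j \<omega>) = 0" if "i \<noteq> j" for i j
    using orth[of i j] orth[of j i] that by (cases "i < j") (auto simp: mult.commute)
  note mom = orthogonal_sum_second_moment[OF _ meas sq orth']
  have diff: "S \<omega> n - S \<omega> m = (\<Sum>i\<in>{m..<n}. D i \<omega>)" if "m \<le> n" for \<omega> m n
    using that by (simp add: S_def sum_diff_nat_ivl lessThan_atLeast0)
  have C: "0 \<le> C"
  proof -
    have "0 \<le> expectation (\<lambda>\<omega>. (D 0 \<omega>)\<^sup>2)" by simp
    also have "\<dots> \<le> C" using le[of 0] by simp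
    finally show ?thesis .
  qed
  have int: "integrable M (\<lambda>\<omega>. (S \<omega> k - S \<omega> m)\<^sup>2)" if "m \<le> k" for k m
    using mom(1)[of "{m..<k}"] by (simp add: diff[OF that])
  have card_le: "real ((Suc j)^3 - j^3) \<le> 7 * (real j)\<^sup>2" if "1 \<le> j" for j
  proof -
    have "real ((Suc j)^3 - j^3) = 3 * (real j)\<^sup>2 + 3 * real j + 1"
      by (subst of_nat_diff) (auto intro!: power_mono simp: power2_eq_square power3_eq_cube algebra_simps)
    moreover have "real j \<le> (real j)\<^sup>2" "1 \<le> (real j)\<^sup>2" using that by (auto simp: self_le_power)
    ultimately show ?thesis by linarith
  qed
  \<comment> \<open>At most 7 j^2 terms, each with second moment at most C / j^6.\<close>
  have var: "expectation (\<lambda>\<omega>. (S \<omega> k - S \<omega> (j^3))\<^sup>2) \<le> 7 * C / (real j)^4"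
    if j: "1 \<le> j" and k: "j^3 \<le> k" "k \<le> (Suc j)^3" for j k
  proof -
    have "expectation (\<lambda>\<omega>. (S \<omega> k - S \<omega> (j^3))\<^sup>2) = (\<Sum>i\<in>{j^3..<k}. expectation (\<lambda>\<omega>. (D i \<omega>)\<^sup>2))"
      using mom(2)[of "{j^3..<k}"] by (simp add: diff[OF k(1)])
    also have "\<dots> \<le> (\<Sum>i\<in>{j^3..<k}. C / (real j)^6)"
    proof (rule sum_mono)
      fix i assume "i \<in> {j^3..<k}"
      then have "real (j^3) \<le> real (Suc i)" by (intro of_nat_mono) auto
      then have "real j^3 \<le> real (Suc i)" by simp
      then have "(real j^3)\<^sup>2 \<le> (real (Suc i))\<^sup>2" by (intro power_mono) auto
      then have "C / (real (Suc i))\<^sup>2 \<le> C / (real j)^6"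
        using C j by (intro divide_left_mono) (auto simp flip: power_mult)
      with le[of i] show "expectation (\<lambda>\<omega>. (D i \<omega>)\<^sup>2) \<le> C / (real j)^6" by linarith
    qed
    also have "\<dots> = real (k - j^3) * (C / (real j)^6)" by simp
    also have "\<dots> \<le> (7 * (real j)\<^sup>2) * (C / (real j)^6)"
    proof (rule mult_right_mono)
      have "real (k - j^3) \<le> real ((Suc j)^3 - j^3)" using k by (intro of_nat_mono) auto
      then show "real (k - j^3) \<le> 7 * (real j)\<^sup>2" using card_le[OF j] by linarith
    qed (use C in auto)
    also have "\<dots> = 7 * C / (real j)^4" using j by (simp add: field_simps flip: power_add)
    finally show ?thesis .
  qed
  \<comment> \<open>The sum over k dominates the maximum over the block; the second summand pays for
    the weight j in \<open>outer\<close>.\<close>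
  define Q where "Q j \<omega> = (\<Sum>k\<in>{j^3..(Suc j)^3}. (S \<omega> k - S \<omega> (j^3))\<^sup>2)
      + (real j)\<^sup>2 * (S \<omega> ((Suc j)^3) - S \<omega> (j^3))\<^sup>2" for j \<omega>
  have le3: "j^3 \<le> (Suc j)^3" for j :: nat by (intro power_mono) auto
  have Qint: "integrable M (Q j)" for j
    unfolding Q_def
    by (intro Bochner_Integration.integrable_add Bochner_Integration.integrable_sum integrable_mult_right int)
       (use le3 in auto)
  \<comment> \<open>A block has at most 8 j^2 values of k, and the weight adds j^2; with 7 C / j^4
    for each this gives 63 C / j^2.\<close>
  have EQ: "expectation (Q j) \<le> 63 * C / (real j)\<^sup>2" if j: "1 \<le> j" for j
  proof -
    have "expectation (Q j) = (\<Sum>k\<in>{j^3..(Suc j)^3}. expectation (\<lambda>\<omega>. (S \<omega> k - S \<omega> (j^3))\<^sup>2))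
        + (real j)\<^sup>2 * expectation (\<lambda>\<omega>. (S \<omega> ((Suc j)^3) - S \<omega> (j^3))\<^sup>2)"
      unfolding Q_def using int le3
      by (subst Bochner_Integration.integral_add)
         (auto intro!: Bochner_Integration.integrable_sum simp del: power_Suc)
    also have "\<dots> \<le> (\<Sum>k\<in>{j^3..(Suc j)^3}. 7 * C / (real j)^4) + (real j)\<^sup>2 * (7 * C / (real j)^4)"
      using var[OF j] le3 by (intro add_mono sum_mono mult_left_mono) auto
    also have "\<dots> = (real (Suc ((Suc j)^3 - j^3)) + (real j)\<^sup>2) * (7 * C / (real j)^4)"
      using le3[of j] by (simp only: sum_constant card_atLeastAtMost Suc_diff_le distrib_right)
    also have "\<dots> \<le> (9 * (real j)\<^sup>2) * (7 * C / (real j)^4)"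
    proof (rule mult_right_mono)
      have "1 \<le> (real j)\<^sup>2" using j by simp
      then show "real (Suc ((Suc j)^3 - j^3)) + (real j)\<^sup>2 \<le> 9 * (real j)\<^sup>2"
        using card_le[OF j] by simp
    qed (use C in auto)
    also have "\<dots> = 63 * C / (real j)\<^sup>2" using j by (simp add: field_simps flip: power_add)
    finally show ?thesis .
  qed
  have "AE \<omega> in M. summable (\<lambda>j. Q (Suc j) \<omega>)"
  proof (rule AE_summable_of_expectation)
    show "integrable M (Q (Suc j))" for j by (rule Qint)
    show "0 \<le> Q (Suc j) \<omega>" for j \<omega> unfolding Q_def by (intro add_nonneg_nonneg sum_nonneg) auto
    show "expectation (Q (Suc j)) \<le> 63 * C * inverse (real (Suc j) ^ 2)" for j
      using EQ[of "Suc j"] by (simp add: divide_inverse)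
    show "summable (\<lambda>j. 63 * C * inverse (real (Suc j) ^ 2))"
      using inverse_power_summable[of 2, where 'a=real]
      by (intro summable_mult) (subst summable_Suc_iff[where f="\<lambda>j. inverse (real j ^ 2)"], simp)
  qed
  then show ?thesis
  proof eventually_elim
    case (elim \<omega>)
    have "convergent (S \<omega>)"
    proof (rule convergent_of_cubic_blocks[where Q="\<lambda>j. Q j \<omega>"])
      show "summable (\<lambda>j. Q j \<omega>)" using elim by (simp only: summable_Suc_iff[where f="\<lambda>j. Q j \<omega>"])
      fix j :: nat
      have "0 \<le> (\<Sum>k\<in>{j^3..(Suc j)^3}. (S \<omega> k - S \<omega> (j^3))\<^sup>2)" by (intro sum_nonneg) auto
      then show "(real j * (S \<omega> ((Suc j)^3) - S \<omega> (j^3)))\<^sup>2 \<le> Q j \<omega>"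
        by (simp add: Q_def power_mult_distrib del: power_Suc)
      fix k assume "j^3 \<le> k" "k \<le> (Suc j)^3"
      then have "(S \<omega> k - S \<omega> (j^3))\<^sup>2 \<le> (\<Sum>k\<in>{j^3..(Suc j)^3}. (S \<omega> k - S \<omega> (j^3))\<^sup>2)"
        by (intro member_le_sum) auto
      moreover have "0 \<le> (real j)\<^sup>2 * (S \<omega> ((Suc j)^3) - S \<omega> (j^3))\<^sup>2" by simp
      ultimately show "(S \<omega> k - S \<omega> (j^3))\<^sup>2 \<le> Q j \<omega>" unfolding Q_def by linarith
    qed
    then show ?case by (simp add: S_def[abs_def])
  qed
qed

section \<open>Chernoff bound\<close>

lemma exp_le_quadratic:
  fixes u :: real
  assumes "\<bar>u\<bar> \<le> 1"
  shows "exp u \<le> 1 + u + u\<^sup>2"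
proof (cases "0 \<le> u")
  case True
  then show ?thesis using exp_bound[of u] assms by simp
next
  case False
  define y where "y = - u"
  have y: "0 \<le> y" "y \<le> 1" using False assms by (auto simp: y_def)
  have "exp u = 1 / exp y" by (simp add: y_def exp_minus divide_inverse)
  also have "\<dots> \<le> 1 / (1 + y)" using y by (intro divide_left_mono exp_ge_add_one_self) auto
  also have "\<dots> \<le> 1 - y + y\<^sup>2"
  proof -
    have "1 \<le> 1 + y ^ 3" using y by simp
    also have "\<dots> = (1 - y + y\<^sup>2) * (1 + y)"
      by (simp add: power2_eq_square power3_eq_cube algebra_simps)
    finally show ?thesis using y by (simp add: pos_divide_le_eq)
  qed
  finally show ?thesis by (simp add: y_def)
qed

text \<open>The condition on l bounds the exponent by 1 in modulus, where exp lies below its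
  quadratic majorant; the linear term has mean 0 and the variance is at most the second
  moment.\<close>

lemma (in prob_space) exp_moment_le:
  fixes Z :: "'a \<Rightarrow> real"
  assumes [measurable]: "Z \<in> borel_measurable M" and b: "\<And>\<omega>. \<bar>Z \<omega>\<bar> \<le> b"
    and v: "expectation (\<lambda>\<omega>. (Z \<omega>)\<^sup>2) \<le> v" and l: "0 \<le> l" "2 * l * b \<le> 1"
  shows "integrable M (\<lambda>\<omega>. exp (l * (Z \<omega> - expectation Z)))"
    and "expectation (\<lambda>\<omega>. exp (l * (Z \<omega> - expectation Z))) \<le> exp (l\<^sup>2 * v)"
proof -
  have int: "integrable M Z" by (rule integrable_const_bound[where B=b]) (use b in auto)
  have sq: "integrable M (\<lambda>\<omega>. (Z \<omega>)\<^sup>2)"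
  proof (rule integrable_const_bound[where B="b\<^sup>2"])
    have "(Z \<omega>)\<^sup>2 \<le> b\<^sup>2" for \<omega> using power_mono[OF b[of \<omega>] abs_ge_zero, of 2] by simp
    then show "AE \<omega> in M. norm ((Z \<omega>)\<^sup>2) \<le> b\<^sup>2" by simp
  qed simp
  define U where "U \<omega> = l * (Z \<omega> - expectation Z)" for \<omega>
  have "\<bar>expectation Z\<bar> \<le> b"
  proof -
    have "\<bar>expectation Z\<bar> \<le> expectation (\<lambda>\<omega>. \<bar>Z \<omega>\<bar>)" by simp
    also have "\<dots> \<le> b" using b int by (intro integral_le_const) auto
    finally show ?thesis .
  qed
  then have "\<bar>Z \<omega> - expectation Z\<bar> \<le> 2 * b" for \<omega> using b[of \<omega>] by linarith
  then have "l * \<bar>Z \<omega> - expectation Z\<bar> \<le> l * (2 * b)" for \<omega> using l by (intro mult_left_mono)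
  moreover have "l * (2 * b) \<le> 1" using l by (simp add: mult_ac)
  ultimately have "l * \<bar>Z \<omega> - expectation Z\<bar> \<le> 1" for \<omega> using order_trans by blast
  then have U1: "\<bar>U \<omega>\<bar> \<le> 1" for \<omega> using l by (simp add: U_def abs_mult)
  have [measurable]: "U \<in> borel_measurable M" unfolding U_def by measurable
  have Ui: "integrable M U" unfolding U_def using int by auto
  have U2i: "integrable M (\<lambda>\<omega>. (U \<omega>)\<^sup>2)"
    by (rule integrable_const_bound[where B="1"]) (use U1 in \<open>auto simp: abs_square_le_1\<close>)
  have expi: "integrable M (\<lambda>\<omega>. exp (U \<omega>))"
  proof (rule integrable_const_bound[where B="exp 1"])
    have "U \<omega> \<le> 1" for \<omega> using U1[of \<omega>] by linarith
    then show "AE \<omega> in M. norm (exp (U \<omega>)) \<le> exp 1" by simp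
  qed simp
  then show "integrable M (\<lambda>\<omega>. exp (l * (Z \<omega> - expectation Z)))" by (simp add: U_def)
  have EU: "expectation U = 0"
    unfolding U_def using int by (simp add: prob_space)
  have "expectation (\<lambda>\<omega>. exp (U \<omega>)) \<le> expectation (\<lambda>\<omega>. 1 + U \<omega> + (U \<omega>)\<^sup>2)"
    by (rule integral_mono) (use expi Ui U2i exp_le_quadratic[OF U1] in auto)
  also have "\<dots> = 1 + expectation (\<lambda>\<omega>. (U \<omega>)\<^sup>2)"
    using Ui U2i EU by (simp add: prob_space)
  also have "expectation (\<lambda>\<omega>. (U \<omega>)\<^sup>2) = l\<^sup>2 * variance Z"
    by (simp add: U_def power_mult_distrib)
  also have "variance Z \<le> v"
    using variance_eq[OF int sq] v zero_le_power2[of "expectation Z"] by linarith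
  also have "1 + l\<^sup>2 * v \<le> exp (l\<^sup>2 * v)" by (rule exp_ge_add_one_self)
  finally show "expectation (\<lambda>\<omega>. exp (l * (Z \<omega> - expectation Z))) \<le> exp (l\<^sup>2 * v)"
    by (simp add: U_def mult_left_mono)
qed

text \<open>The second moment v is kept apart from the range b. For the kernel terms both are of
  order n^\<alpha>, which yields an exponent of order n^(1-\<alpha>); a bound by the range alone
  would yield n^(1-2\<alpha>), useless for \<alpha> \<ge> 1/2.\<close>

lemma (in prob_space) chernoff_upper:
  fixes Z :: "'i \<Rightarrow> 'a \<Rightarrow> real"
  assumes indep: "indep_vars (\<lambda>_. borel) Z I" and fin: "finite I"
    and b: "\<And>i \<omega>. i \<in> I \<Longrightarrow> \<bar>Z i \<omega>\<bar> \<le> b"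
    and v: "\<And>i. i \<in> I \<Longrightarrow> expectation (\<lambda>\<omega>. (Z i \<omega>)\<^sup>2) \<le> v" and l: "0 < l" "2 * l * b \<le> 1"
  shows "prob {\<omega> \<in> space M. t \<le> (\<Sum>i\<in>I. Z i \<omega> - expectation (Z i))} \<le> exp (real (card I) * l\<^sup>2 * v - l * t)"
proof -
  have [measurable]: "Z i \<in> borel_measurable M" if "i \<in> I" for i
    using indep that by (auto simp: indep_vars_def)
  let ?E = "\<lambda>i \<omega>. exp (l * (Z i \<omega> - expectation (Z i)))"
  have ind: "indep_vars (\<lambda>_. borel) ?E I"
    by (intro indep_vars_compose2[OF indep]) auto
  have int: "integrable M (?E i)" if "i \<in> I" for i
    using that b v l by (intro exp_moment_le[where b=b and v=v]) auto
  have exp_sum_eq: "exp (l * (\<Sum>i\<in>I. Z i \<omega> - expectation (Z i))) = (\<Prod>i\<in>I. ?E i \<omega>)" for \<omega>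
    by (simp add: sum_distrib_left exp_sum fin)
  have "set_integrable M (space M) (\<lambda>\<omega>. \<Prod>i\<in>I. ?E i \<omega>)"
    unfolding set_integrable_def
    by (intro integrable_mult_indicator indep_vars_integrable[OF fin ind int]) auto
  then have "prob {\<omega> \<in> space M. t \<le> (\<Sum>i\<in>I. Z i \<omega> - expectation (Z i))}
      \<le> exp (- l * t) * (\<integral>\<omega>\<in>space M. exp (l * (\<Sum>i\<in>I. Z i \<omega> - expectation (Z i))) \<partial>M)"
    by (intro Chernoff_ineq_ge[OF l(1)]) (auto simp only: exp_sum_eq)
  also have "(\<integral>\<omega>\<in>space M. exp (l * (\<Sum>i\<in>I. Z i \<omega> - expectation (Z i))) \<partial>M) = expectation (\<lambda>\<omega>. \<Prod>i\<in>I. ?E i \<omega>)"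
    by (simp add: exp_sum_eq set_integral_space indep_vars_integrable[OF fin ind int])
  also have "\<dots> = (\<Prod>i\<in>I. expectation (?E i))"
    by (rule indep_vars_lebesgue_integral[OF fin ind int])
  also have "exp (- l * t) * \<dots> \<le> exp (- l * t) * (\<Prod>i\<in>I. exp (l\<^sup>2 * v))"
    using b v l by (intro mult_left_mono prod_mono conjI exp_moment_le(2)[where b=b]) auto
  also have "\<dots> = exp (real (card I) * l\<^sup>2 * v - l * t)"
    by (simp add: exp_diff exp_minus field_simps flip: exp_of_nat_mult)
  finally show ?thesis .
qed

lemma (in prob_space) chernoff_two_sided:
  fixes Z :: "'i \<Rightarrow> 'a \<Rightarrow> real"
  assumes indep: "indep_vars (\<lambda>_. borel) Z I" and fin: "finite I"
    and b: "\<And>i \<omega>. i \<in> I \<Longrightarrow> \<bar>Z i \<omega>\<bar> \<le> b"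
    and v: "\<And>i. i \<in> I \<Longrightarrow> expectation (\<lambda>\<omega>. (Z i \<omega>)\<^sup>2) \<le> v" and l: "0 < l" "2 * l * b \<le> 1"
  shows "prob {\<omega> \<in> space M. t \<le> \<bar>\<Sum>i\<in>I. Z i \<omega> - expectation (Z i)\<bar>}
       \<le> 2 * exp (real (card I) * l\<^sup>2 * v - l * t)"
proof -
  have [measurable]: "Z i \<in> borel_measurable M" if "i \<in> I" for i
    using indep that by (auto simp: indep_vars_def)
  have indep': "indep_vars (\<lambda>_. borel) (\<lambda>i \<omega>. - Z i \<omega>) I"
    by (intro indep_vars_compose2[OF indep]) auto
  have neg: "(\<Sum>i\<in>I. - Z i \<omega> - expectation (\<lambda>\<omega>. - Z i \<omega>)) = - (\<Sum>i\<in>I. Z i \<omega> - expectation (Z i))" for \<omega>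
    by (simp add: sum_subtractf sum_negf)
  have "{\<omega> \<in> space M. t \<le> \<bar>\<Sum>i\<in>I. Z i \<omega> - expectation (Z i)\<bar>} =
      {\<omega> \<in> space M. t \<le> (\<Sum>i\<in>I. Z i \<omega> - expectation (Z i))} \<union>
      {\<omega> \<in> space M. t \<le> (\<Sum>i\<in>I. - Z i \<omega> - expectation (\<lambda>\<omega>. - Z i \<omega>))}"
    unfolding neg by auto
  also have "prob \<dots> \<le> prob {\<omega> \<in> space M. t \<le> (\<Sum>i\<in>I. Z i \<omega> - expectation (Z i))} +
      prob {\<omega> \<in> space M. t \<le> (\<Sum>i\<in>I. - Z i \<omega> - expectation (\<lambda>\<omega>. - Z i \<omega>))}"
    by (intro measure_Un_le) measurable
  also have "\<dots> \<le> exp (real (card I) * l\<^sup>2 * v - l * t) + exp (real (card I) * l\<^sup>2 * v - l * t)"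
    using b v by (intro add_mono chernoff_upper[OF indep fin] chernoff_upper[OF indep' fin]) (use l in auto)
  finally show ?thesis by simp
qed

section \<open>Noise driven by independent coordinates\<close>

text \<open>Resetting the coordinates outside J to 0 keeps every truncated path in the same
  measurable space, so that the pasts at different times need no separate product spaces.\<close>

definition cut :: "'i set \<Rightarrow> ('i \<Rightarrow> real) \<Rightarrow> 'i \<Rightarrow> real" where
  "cut J p = (\<lambda>i. if i \<in> J then p i else 0)"

lemma cut_simps [simp]:
  "i \<in> J \<Longrightarrow> cut J p i = p i" "I \<subseteq> J \<Longrightarrow> cut I (cut J p) = cut I p"
  by (auto simp: cut_def fun_eq_iff)

abbreviation path_space :: "('i \<Rightarrow> real) measure" where
  "path_space \<equiv> PiM UNIV (\<lambda>_. borel)"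

text \<open>Disjoint blocks of coordinates are independent. \<open>cut\<close> turns restrictions
  into full paths, and evaluation at j extracts the new variable from the path cut to {j}.\<close>

lemma (in prob_space) distr_cut_pair:
  fixes W :: "'i \<Rightarrow> 'a \<Rightarrow> real"
  assumes indep: "indep_vars (\<lambda>_. borel) W UNIV" and j: "j \<notin> J"
  shows "distr M path_space (\<lambda>\<omega>. cut J (\<lambda>i. W i \<omega>)) \<Otimes>\<^sub>M distr M borel (W j) =
      distr M (path_space \<Otimes>\<^sub>M borel) (\<lambda>\<omega>. (cut J (\<lambda>i. W i \<omega>), W j \<omega>))"
proof -
  have [measurable]: "W i \<in> borel_measurable M" for i using indep by (auto simp: indep_vars_def)
  define P where "P I \<omega> = cut I (\<lambda>i. W i \<omega>)" for I \<omega>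
  have [measurable]: "P I \<in> M \<rightarrow>\<^sub>M path_space" for I
    unfolding P_def by (rule measurable_PiM_single') (auto simp: cut_def)
  have cut_meas: "cut I \<in> PiM I (\<lambda>_. borel) \<rightarrow>\<^sub>M path_space" for I :: "'i set"
  proof (rule measurable_PiM_single')
    fix i :: 'i
    show "(\<lambda>p. cut I p i) \<in> borel_measurable (PiM I (\<lambda>_. borel))"
      by (cases "i \<in> I") (auto simp: cut_def)
  qed auto
  have "indep_var (PiM J (\<lambda>_. borel)) (\<lambda>\<omega>. restrict (\<lambda>i. W i \<omega>) J)
      (PiM {j} (\<lambda>_. borel)) (\<lambda>\<omega>. restrict (\<lambda>i. W i \<omega>) {j})"
    by (rule indep_var_restrict[OF indep]) (use j in auto)
  then have "indep_var path_space (cut J \<circ> (\<lambda>\<omega>. restrict (\<lambda>i. W i \<omega>) J))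
      path_space (cut {j} \<circ> (\<lambda>\<omega>. restrict (\<lambda>i. W i \<omega>) {j}))"
    by (rule indep_var_compose) (rule cut_meas)+
  moreover have "cut I \<circ> (\<lambda>\<omega>. restrict (\<lambda>i. W i \<omega>) I) = P I" for I
    by (auto simp: cut_def P_def fun_eq_iff)
  ultimately have "indep_var path_space (P J) path_space (P {j})" by simp
  then have joint: "distr M path_space (P J) \<Otimes>\<^sub>M distr M path_space (P {j}) =
      distr M (path_space \<Otimes>\<^sub>M path_space) (\<lambda>\<omega>. (P J \<omega>, P {j} \<omega>))"
    unfolding indep_var_distribution_eq by blast
  have Pj: "P {j} \<omega> j = W j \<omega>" for \<omega> by (simp add: P_def)
  have Wj: "distr M borel (W j) = distr (distr M path_space (P {j})) borel (\<lambda>q. q j)"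
    by (subst distr_distr) (auto simp: comp_def Pj)
  have PJ: "distr M path_space (P J) = distr (distr M path_space (P J)) path_space (\<lambda>q. q)"
    by (subst distr_distr) (auto simp: comp_def)
  interpret DZ: prob_space "distr M borel (W j)" by (rule prob_space_distr) simp
  have "distr M path_space (P J) \<Otimes>\<^sub>M distr M borel (W j) =
      distr (distr M path_space (P J)) path_space (\<lambda>q. q) \<Otimes>\<^sub>M distr (distr M path_space (P {j})) borel (\<lambda>q. q j)"
    using PJ Wj by simp
  also have "\<dots> = distr (distr M path_space (P J) \<Otimes>\<^sub>M distr M path_space (P {j})) (path_space \<Otimes>\<^sub>M borel)
      (\<lambda>(x, y). (x, y j))"
    by (intro pair_measure_distr) (auto simp: Wj[symmetric] DZ.sigma_finite_measure_axioms)
  also have "\<dots> = distr M (path_space \<Otimes>\<^sub>M borel) (\<lambda>\<omega>. (P J \<omega>, W j \<omega>))"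
    unfolding joint by (subst distr_distr) (auto simp: comp_def Pj)
  finally show ?thesis by (simp add: P_def[abs_def])
qed

text \<open>Plays the part of the tower property: by Fubini the past P is frozen and only the fresh
  variable Z is averaged.\<close>

lemma (in prob_space) expectation_eq_0_of_product_law:
  fixes \<phi> :: "'b \<times> real \<Rightarrow> real"
  assumes [measurable]: "P \<in> M \<rightarrow>\<^sub>M S" "Z \<in> borel_measurable M"
    and dist: "distr M S P \<Otimes>\<^sub>M distr M borel Z = distr M (S \<Otimes>\<^sub>M borel) (\<lambda>\<omega>. (P \<omega>, Z \<omega>))"
    and [measurable]: "\<phi> \<in> borel_measurable (S \<Otimes>\<^sub>M borel)"
    and int: "integrable M (\<lambda>\<omega>. \<phi> (P \<omega>, Z \<omega>))"
    and zero: "\<And>p. p \<in> space S \<Longrightarrow> (\<integral>z. \<phi> (p, z) \<partial>distr M borel Z) = 0"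
  shows "expectation (\<lambda>\<omega>. \<phi> (P \<omega>, Z \<omega>)) = 0"
proof -
  interpret DP: prob_space "distr M S P" by (rule prob_space_distr) simp
  interpret DZ: prob_space "distr M borel Z" by (rule prob_space_distr) simp
  interpret pair_sigma_finite "distr M S P" "distr M borel Z" ..
  have "expectation (\<lambda>\<omega>. \<phi> (P \<omega>, Z \<omega>)) = integral\<^sup>L (distr M (S \<Otimes>\<^sub>M borel) (\<lambda>\<omega>. (P \<omega>, Z \<omega>))) \<phi>"
    by (subst integral_distr) auto
  also have "\<dots> = integral\<^sup>L (distr M S P \<Otimes>\<^sub>M distr M borel Z) \<phi>" by (simp add: dist)
  also have "\<dots> = (\<integral>p. (\<integral>z. \<phi> (p, z) \<partial>distr M borel Z) \<partial>distr M S P)"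
    by (subst integral_fst') (auto simp: dist integrable_distr_eq int)
  also have "\<dots> = 0"
    using zero by (subst Bochner_Integration.integral_cong[where g="\<lambda>_. 0"]) auto
  finally show ?thesis .
qed

text \<open>A martingale convergence statement in coordinates: \<open>J n\<close> lists the
  coordinates already revealed, \<open>j n\<close> the one being averaged, \<open>dep\<close> is
  adaptedness and \<open>zero\<close> the centring with the past frozen.\<close>

lemma (in prob_space) noise_series_AE_convergent:
  fixes W :: "'i \<Rightarrow> 'a \<Rightarrow> real" and \<Phi> :: "nat \<Rightarrow> ('i \<Rightarrow> real) \<times> real \<Rightarrow> real"
  assumes indep: "indep_vars (\<lambda>_. borel) W UNIV"
    and new: "\<And>n. j n \<notin> J n" and past: "\<And>m n. m < n \<Longrightarrow> insert (j m) (J m) \<subseteq> J n"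
    and meas[measurable]: "\<And>n. \<Phi> n \<in> borel_measurable (path_space \<Otimes>\<^sub>M borel)"
    and dep: "\<And>n p z. \<Phi> n (cut (J n) p, z) = \<Phi> n (p, z)"
    and bound: "\<And>n p z. \<bar>\<Phi> n (p, z)\<bar> \<le> B * (1 + \<bar>z\<bar>)"
    and sq: "\<And>n. integrable M (\<lambda>\<omega>. (W (j n) \<omega>)\<^sup>2)" "\<And>n. expectation (\<lambda>\<omega>. (W (j n) \<omega>)\<^sup>2) \<le> v"
    and zero: "\<And>n p. (\<integral>z. \<Phi> n (p, z) \<partial>distr M borel (W (j n))) = 0"
  shows "AE \<omega> in M. convergent (\<lambda>n. \<Sum>k<n. \<Phi> k (\<lambda>i. W i \<omega>, W (j k) \<omega>) / real (Suc k))"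
proof (rule orthogonal_series_AE_convergent[where C="2 * B\<^sup>2 * (1 + v)"])
  have [measurable]: "W i \<in> borel_measurable M" for i using indep by (auto simp: indep_vars_def)
  have [measurable]: "(\<lambda>\<omega> i. W i \<omega>) \<in> M \<rightarrow>\<^sub>M path_space"
    by (rule measurable_PiM_single') auto
  have [measurable]: "(\<lambda>\<omega>. cut I (\<lambda>i. W i \<omega>)) \<in> M \<rightarrow>\<^sub>M path_space" for I
    by (rule measurable_PiM_single') (auto simp: cut_def)
  define D where "D k \<omega> = \<Phi> k (\<lambda>i. W i \<omega>, W (j k) \<omega>) / real (Suc k)" for k \<omega>
  show Dm: "(\<lambda>\<omega>. \<Phi> k (\<lambda>i. W i \<omega>, W (j k) \<omega>) / real (Suc k)) \<in> borel_measurable M" for k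
    by measurable
  note [measurable] = Dm[folded D_def]
  have B: "0 \<le> B" using bound[of 0 _ 0] abs_ge_zero by (metis add.right_neutral abs_zero mult.right_neutral order_trans)
  \<comment> \<open>The constant 2 comes from (1 + |z|)^2 \<le> 2 (1 + z^2).\<close>
  have D2: "(D k \<omega>)\<^sup>2 \<le> 2 * B\<^sup>2 * (1 + (W (j k) \<omega>)\<^sup>2) / (real (Suc k))\<^sup>2" for k \<omega>
  proof -
    have "(\<Phi> k (\<lambda>i. W i \<omega>, W (j k) \<omega>))\<^sup>2 \<le> (B * (1 + \<bar>W (j k) \<omega>\<bar>))\<^sup>2"
      using bound[of k "\<lambda>i. W i \<omega>" "W (j k) \<omega>"] by (rule abs_le_square_iff[THEN iffD1, OF order_trans]) simp
    also have "\<dots> = B\<^sup>2 * (1 + \<bar>W (j k) \<omega>\<bar>)\<^sup>2" by (rule power_mult_distrib)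
    also have "\<dots> \<le> B\<^sup>2 * (2 * (1 + (W (j k) \<omega>)\<^sup>2))"
      using zero_le_power2[of "1 - \<bar>W (j k) \<omega>\<bar>"]
      by (intro mult_left_mono) (auto simp: power2_sum power2_diff)
    finally have "(\<Phi> k (\<lambda>i. W i \<omega>, W (j k) \<omega>))\<^sup>2 \<le> 2 * B\<^sup>2 * (1 + (W (j k) \<omega>)\<^sup>2)" by (simp only: mult_ac)
    then show ?thesis unfolding D_def power_divide by (rule divide_right_mono) simp
  qed
  have bd_int: "integrable M (\<lambda>\<omega>. 2 * B\<^sup>2 * (1 + (W (j k) \<omega>)\<^sup>2) / (real (Suc k))\<^sup>2)" for k
    using sq(1) by auto
  have Dsq: "integrable M (\<lambda>\<omega>. (D k \<omega>)\<^sup>2)" for k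
    by (rule Bochner_Integration.integrable_bound[OF bd_int[of k]]) (use D2 in \<open>auto intro!: AE_I2 order_trans[OF D2 abs_ge_self]\<close>)
  then show "integrable M (\<lambda>\<omega>. (\<Phi> k (\<lambda>i. W i \<omega>, W (j k) \<omega>) / real (Suc k))\<^sup>2)" for k
    by (simp only: D_def)
  have "expectation (\<lambda>\<omega>. (D k \<omega>)\<^sup>2) \<le> 2 * B\<^sup>2 * (1 + v) / (real (Suc k))\<^sup>2" for k
  proof -
    have "expectation (\<lambda>\<omega>. (D k \<omega>)\<^sup>2) \<le> expectation (\<lambda>\<omega>. 2 * B\<^sup>2 * (1 + (W (j k) \<omega>)\<^sup>2) / (real (Suc k))\<^sup>2)"
      by (rule integral_mono[OF Dsq bd_int D2])
    also have "\<dots> = 2 * B\<^sup>2 * (1 + expectation (\<lambda>\<omega>. (W (j k) \<omega>)\<^sup>2)) / (real (Suc k))\<^sup>2"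
      using sq(1) by (simp add: prob_space)
    also have "\<dots> \<le> 2 * B\<^sup>2 * (1 + v) / (real (Suc k))\<^sup>2"
      using sq(2)[of k] by (intro divide_right_mono mult_left_mono) auto
    finally show ?thesis .
  qed
  then show "expectation (\<lambda>\<omega>. (\<Phi> k (\<lambda>i. W i \<omega>, W (j k) \<omega>) / real (Suc k))\<^sup>2)
      \<le> 2 * B\<^sup>2 * (1 + v) / (real (Suc k))\<^sup>2" for k
    by (simp only: D_def)
  fix m n :: nat assume mn: "m < n"
  \<comment> \<open>The earlier factor reads only \<open>J m\<close> and \<open>j m\<close>, all
    contained in \<open>J n\<close>. The product is therefore a function of the path cut to
    \<open>J n\<close> and the new coordinate, which occurs in the later factor only.\<close>
  define \<psi> where "\<psi> q = (case q of (p, z) \<Rightarrow> \<Phi> m (p, p (j m)) / real (Suc m) * (\<Phi> n (p, z) / real (Suc n)))" for q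
  have eq: "D m \<omega> * D n \<omega> = \<psi> (cut (J n) (\<lambda>i. W i \<omega>), W (j n) \<omega>)" for \<omega>
  proof -
    have "\<Phi> m (cut (J n) (\<lambda>i. W i \<omega>), W (j m) \<omega>) = \<Phi> m (cut (J m) (cut (J n) (\<lambda>i. W i \<omega>)), W (j m) \<omega>)"
      by (simp add: dep)
    also have "cut (J m) (cut (J n) (\<lambda>i. W i \<omega>)) = cut (J m) (\<lambda>i. W i \<omega>)"
      using past[OF mn] by simp
    finally show ?thesis using past[OF mn] by (simp add: \<psi>_def D_def dep)
  qed
  have "expectation (\<lambda>\<omega>. \<psi> (cut (J n) (\<lambda>i. W i \<omega>), W (j n) \<omega>)) = 0"
  proof (rule expectation_eq_0_of_product_law[OF _ _ distr_cut_pair[OF indep new]])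
    show "\<psi> \<in> borel_measurable (path_space \<Otimes>\<^sub>M borel)"
      unfolding \<psi>_def by measurable
    have "integrable M (\<lambda>\<omega>. D m \<omega> * D n \<omega>)"
    proof (rule Bochner_Integration.integrable_bound[where f="\<lambda>\<omega>. (D m \<omega>)\<^sup>2 + (D n \<omega>)\<^sup>2"])
      show "AE \<omega> in M. norm (D m \<omega> * D n \<omega>) \<le> norm ((D m \<omega>)\<^sup>2 + (D n \<omega>)\<^sup>2)"
        using abs_mult_le_sum_squares by auto
    qed (use Dsq in auto)
    then show "integrable M (\<lambda>\<omega>. \<psi> (cut (J n) (\<lambda>i. W i \<omega>), W (j n) \<omega>))" by (simp add: eq)
    show "(\<lambda>\<omega>. cut (J n) (\<lambda>i. W i \<omega>)) \<in> M \<rightarrow>\<^sub>M path_space" "W (j n) \<in> borel_measurable M"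
      by measurable
    show "(\<integral>z. \<psi> (p, z) \<partial>distr M borel (W (j n))) = 0" for p
      using zero[of n p] by (simp add: \<psi>_def)
  qed
  then show "expectation (\<lambda>\<omega>. \<Phi> m (\<lambda>i. W i \<omega>, W (j m) \<omega>) / real (Suc m) *
       (\<Phi> n (\<lambda>i. W i \<omega>, W (j n) \<omega>) / real (Suc n))) = 0"
    unfolding eq[symmetric] by (simp only: D_def)
qed

section \<open>Recursive kernel density estimation\<close>

text \<open>The cubic factor counts the grid points in a union bound; the exponential is the
  deviation bound at each of them.\<close>

lemma summable_cubic_exp_powr:
  fixes C \<beta> :: real
  assumes C: "0 < C" and \<beta>: "0 < \<beta>"
  shows "summable (\<lambda>n. (real n ^ 3 + 1) * exp (- (C * real n powr \<beta>)))"
proof -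
  \<comment> \<open>With \<beta> k \<ge> 5, the power y^k is at least C^k n^5 and is eventually
    beaten by exp y; after the factor n^3 a summable n^-2 remains.\<close>
  obtain k :: nat where k: "5 / \<beta> \<le> real k" using real_arch_simple by blast
  then have k5: "5 \<le> \<beta> * real k" using \<beta> by (simp add: field_simps)
  define y where "y n = C * real n powr \<beta>" for n
  have "filterlim (\<lambda>n. real n powr \<beta>) at_top sequentially"
  proof (rule filterlim_cong[THEN iffD1, OF refl refl])
    show "filterlim (\<lambda>n. exp (\<beta> * ln (real n))) at_top sequentially"
      using \<beta> by (intro filterlim_compose[OF exp_at_top] filterlim_tendsto_pos_mult_at_top[OF tendsto_const]
          filterlim_compose[OF ln_at_top filterlim_real_sequentially])
    show "eventually (\<lambda>n. exp (\<beta> * ln (real n)) = real n powr \<beta>) sequentially"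
      using eventually_gt_at_top[of 0] by eventually_elim (simp add: powr_def)
  qed
  then have "filterlim y at_top sequentially"
    unfolding y_def using C by (intro filterlim_tendsto_pos_mult_at_top[OF tendsto_const])
  then have "(\<lambda>n. y n ^ k / exp (y n)) \<longlonglongrightarrow> 0"
    by (rule filterlim_compose[OF tendsto_power_div_exp_0])
  then have "eventually (\<lambda>n. y n ^ k / exp (y n) < 1) sequentially"
    by (rule order_tendstoD) simp
  then have "eventually (\<lambda>n. norm ((real n ^ 3 + 1) * exp (- y n)) \<le> 2 / C ^ k * inverse (real n ^ 2)) sequentially"
    using eventually_ge_at_top[of 1]
  proof eventually_elim
    case (elim n)
    have n: "1 \<le> real n" using elim by simp
    have "real n ^ 5 = real n powr 5" using n by (simp add: powr_numeral)
    also have "\<dots> \<le> real n powr (\<beta> * real k)" using n k5 by (intro powr_mono) auto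
    also have "\<dots> = (real n powr \<beta>) ^ k" using n by (simp add: powr_powr[symmetric] powr_realpow)
    also have "\<dots> = y n ^ k / C ^ k" using C by (simp add: y_def power_mult_distrib)
    finally have n5: "real n ^ 5 \<le> y n ^ k / C ^ k" .
    have "(real n ^ 3 + 1) * exp (- y n) \<le> (2 * real n ^ 3) * exp (- y n)"
      using n by (intro mult_right_mono) auto
    also have "\<dots> = 2 * real n ^ 5 * exp (- y n) * inverse (real n ^ 2)"
      using n by (simp add: field_simps flip: power_add)
    also have "\<dots> \<le> 2 * (y n ^ k / C ^ k) * exp (- y n) * inverse (real n ^ 2)"
      using n5 by (intro mult_right_mono mult_left_mono) auto
    also have "\<dots> = 2 / C ^ k * inverse (real n ^ 2) * (y n ^ k / exp (y n))"
      by (simp add: exp_minus divide_inverse mult_ac)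
    also have "\<dots> \<le> 2 / C ^ k * inverse (real n ^ 2) * 1"
      using elim(1) C by (intro mult_left_mono) auto
    finally show ?case by (simp add: abs_mult)
  qed
  moreover have "summable (\<lambda>n. 2 / C ^ k * inverse (real n ^ 2))"
    by (intro summable_mult inverse_power_summable) simp
  ultimately have "summable (\<lambda>n. (real n ^ 3 + 1) * exp (- y n))"
    by (rule summable_comparison_test_ev)
  then show ?thesis by (simp add: y_def)
qed

lemma Cesaro_tendsto:
  fixes a :: "nat \<Rightarrow> real"
  assumes a: "a \<longlonglongrightarrow> l"
  shows "(\<lambda>n. (1 / real n) * (\<Sum>i=1..n. a i)) \<longlonglongrightarrow> l"
proof -
  have "(\<lambda>n. (1 / real n) * (\<Sum>i=1..n. a i) - l) \<longlonglongrightarrow> 0"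
  proof (rule LIMSEQ_I)
    fix e :: real assume e: "0 < e"
    obtain N where N: "\<And>i. i \<ge> N \<Longrightarrow> \<bar>a i - l\<bar> < e / 2"
      using LIMSEQ_D[OF a, of "e/2"] e by auto
    define A where "A = (\<Sum>i=1..N. \<bar>a i - l\<bar>)"
    have A: "0 \<le> A" unfolding A_def by (intro sum_nonneg) auto
    obtain n0 :: nat where n0: "2 * A / e < real n0" using reals_Archimedean2 by blast
    have "norm ((1 / real n) * (\<Sum>i=1..n. a i) - l - 0) < e" if n: "n \<ge> max n0 (max N 1)" for n
    proof -
      have n1: "n \<ge> 1" "n \<ge> N" "n \<ge> n0" using n by auto
      have "(1 / real n) * (\<Sum>i=1..n. a i) - l = (1 / real n) * (\<Sum>i=1..n. a i - l)"
        using n1 by (simp add: sum_subtractf field_simps)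
      then have "\<bar>(1 / real n) * (\<Sum>i=1..n. a i) - l\<bar> \<le> (1 / real n) * (\<Sum>i=1..n. \<bar>a i - l\<bar>)"
        by (simp add: abs_mult mult_left_mono divide_right_mono)
      also have "(\<Sum>i=1..n. \<bar>a i - l\<bar>) = A + (\<Sum>i=Suc N..n. \<bar>a i - l\<bar>)"
      proof -
        have "{1..n} = {1..N} \<union> {Suc N..n}" using n1 by auto
        then show ?thesis unfolding A_def by (simp add: sum.union_disjoint)
      qed
      also have "(\<Sum>i=Suc N..n. \<bar>a i - l\<bar>) \<le> (\<Sum>i=Suc N..n. e / 2)"
        by (intro sum_mono less_imp_le N) auto
      also have "\<dots> \<le> real n * (e / 2)" using e n1 by (simp add: mult_right_mono)
      also have "(1 / real n) * (A + real n * (e / 2)) = A / real n + e / 2"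
        using n1 by (simp add: field_simps)
      also have "A / real n < e / 2"
      proof -
        have "2 * A / e < real n" using n0 n1 by (meson less_le_trans of_nat_mono)
        then have "2 * A < real n * e" using e by (simp add: pos_divide_less_eq)
        then show ?thesis using n1 by (simp add: pos_divide_less_eq mult.commute)
      qed
      finally show ?thesis using n1 by (simp add: mult_left_mono divide_right_mono)
    qed
    then show "\<exists>no. \<forall>n\<ge>no. norm ((1 / real n) * (\<Sum>i=1..n. a i) - l - 0) < e" by blast
  qed
  then show ?thesis by (simp add: LIM_zero_iff)
qed

text \<open>The qualitative assumptions on g and K appear here as explicit constants. Continuity of
  g is asked for in the open interval only, because the density on the whole line may jump at the
  end points.\<close>

locale kernel_density = prob_space M for M :: "'a measure" +
  fixes X :: "nat \<Rightarrow> 'a \<Rightarrow> real" and g K :: "real \<Rightarrow> real" and \<alpha> c G \<kappa> L R :: real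
  assumes X_indep: "indep_vars (\<lambda>_. borel) X UNIV"
    and X_dens: "\<And>n. distributed M lborel (X n) (\<lambda>x. ennreal (g x))"
    and c_pos: "0 < c" and g_ge: "\<And>x. x \<in> {-1/2..1/2} \<Longrightarrow> c \<le> g x"
    and g_nonneg: "\<And>x. 0 \<le> g x" and g_le: "\<And>x. g x \<le> G"
    and g_isCont: "\<And>x. x \<in> {-1/2<..<1/2} \<Longrightarrow> isCont g x"
    and K_nonneg: "\<And>x. 0 \<le> K x" and K_le: "\<And>x. K x \<le> \<kappa>" and \<kappa>_pos: "0 < \<kappa>"
    and K_lipschitz: "\<And>x y. \<bar>K x - K y\<bar> \<le> L * \<bar>x - y\<bar>"
    and K_even: "\<And>x. K (- x) = K x"
    and R_pos: "0 < R" and K_support: "\<And>x. R < \<bar>x\<bar> \<Longrightarrow> K x = 0"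
    and K_integrable: "integrable lborel K" and K_integral: "integral\<^sup>L lborel K = 1"
    and \<alpha>: "0 < \<alpha>" "\<alpha> < 1"
begin

definition kern :: "nat \<Rightarrow> real \<Rightarrow> real \<Rightarrow> real" where
  "kern i x y = 1 / bw \<alpha> i * K ((y - x) / bw \<alpha> i)"

definition kern_mean :: "nat \<Rightarrow> real \<Rightarrow> real" where
  "kern_mean i x = expectation (\<lambda>\<omega>. kern i x (X i \<omega>))"

definition ghat_mean :: "nat \<Rightarrow> real \<Rightarrow> real" where
  "ghat_mean n x = (1 / real n) * (\<Sum>i=1..n. kern_mean i x)"

lemma ghat_eq: "ghat K \<alpha> X n x \<omega> = (1 / real n) * (\<Sum>i=1..n. kern i x (X i \<omega>))"
  by (simp add: ghat_def kern_def)

lemma X_measurable [measurable]: "X n \<in> borel_measurable M"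
  using distributed_measurable[OF X_dens[of n]] by simp

lemma g_measurable [measurable]: "g \<in> borel_measurable borel"
  using distributed_real_measurable[OF g_nonneg X_dens[of 0]] by simp

lemma L_nonneg: "0 \<le> L"
  using order_trans[OF abs_ge_zero K_lipschitz[of 1 0]] by simp

lemma K_measurable [measurable]: "K \<in> borel_measurable borel"
  using borel_measurable_integrable[OF K_integrable] by simp

lemma G_pos: "0 < G"
  using g_ge[of 0] g_le[of 0] c_pos by simp

section \<open>Elementary bounds on the kernel terms\<close>

lemma bw_pos: "1 \<le> i \<Longrightarrow> 0 < bw \<alpha> i"
  by (simp add: bw_def)

lemma inverse_bw_le: "1 \<le> i \<Longrightarrow> i \<le> n \<Longrightarrow> 1 / bw \<alpha> i \<le> real n powr \<alpha>"
  using \<alpha> by (simp add: bw_def powr_minus divide_inverse powr_mono2)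

lemma inverse_bw_le_n: "1 \<le> i \<Longrightarrow> i \<le> n \<Longrightarrow> 1 / bw \<alpha> i \<le> real n"
  using inverse_bw_le[of i n] powr_mono[of \<alpha> 1 "real n"] \<alpha> by simp

lemma bw_tendsto_0: "bw \<alpha> \<longlonglongrightarrow> 0"
  unfolding bw_def[abs_def] using \<alpha>(1)
  by (intro tendsto_neg_powr filterlim_real_sequentially) auto

lemma kern_measurable [measurable]: "kern i x \<in> borel_measurable borel"
  unfolding kern_def by measurable

lemma kern_nonneg: "0 \<le> kern i x y"
  by (simp add: kern_def bw_def K_nonneg)

lemma kern_le: "1 \<le> i \<Longrightarrow> i \<le> n \<Longrightarrow> kern i x y \<le> \<kappa> * real n powr \<alpha>"
  using mult_mono[OF inverse_bw_le[of i n] K_le[of "(y - x) / bw \<alpha> i"]] K_nonneg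
  by (simp add: kern_def mult.commute)

text \<open>Rescaling multiplies the Lipschitz constant by the inverse square of the bandwidth, and
  the inverse bandwidth is crudely at most n. The resulting n^2 is what dictates a grid of mesh
  n^-3.\<close>

lemma kern_lipschitz:
  assumes "1 \<le> i" "i \<le> n"
  shows "\<bar>kern i x y - kern i x' y\<bar> \<le> real n ^ 2 * L * \<bar>x - x'\<bar>"
proof -
  note h = bw_pos[OF assms(1)]
  have "(y - x) / bw \<alpha> i - (y - x') / bw \<alpha> i = (x' - x) / bw \<alpha> i"
    by (simp add: diff_divide_distrib)
  then have "\<bar>K ((y - x) / bw \<alpha> i) - K ((y - x') / bw \<alpha> i)\<bar> \<le> L * \<bar>(x' - x) / bw \<alpha> i\<bar>"
    using K_lipschitz[of "(y - x) / bw \<alpha> i" "(y - x') / bw \<alpha> i"] by simp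
  also have "\<dots> = L * \<bar>x - x'\<bar> * (1 / bw \<alpha> i)"
    using h by (simp add: abs_minus_commute)
  also have "\<dots> \<le> L * \<bar>x - x'\<bar> * real n"
    using inverse_bw_le_n[OF assms] L_nonneg by (intro mult_left_mono) auto
  finally have "(1 / bw \<alpha> i) * \<bar>K ((y - x) / bw \<alpha> i) - K ((y - x') / bw \<alpha> i)\<bar>
      \<le> real n * (L * \<bar>x - x'\<bar> * real n)"
    using inverse_bw_le_n[OF assms] by (intro mult_mono) auto
  moreover have "\<bar>kern i x y - kern i x' y\<bar>
      = (1 / bw \<alpha> i) * \<bar>K ((y - x) / bw \<alpha> i) - K ((y - x') / bw \<alpha> i)\<bar>"
    unfolding kern_def using h by (simp add: abs_mult flip: right_diff_distrib diff_divide_distrib)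
  ultimately show ?thesis by (simp add: power2_eq_square mult_ac)
qed

lemma kern_integrable:
  assumes "1 \<le> i"
  shows "integrable M (\<lambda>\<omega>. kern i x (X i \<omega>))"
  by (rule integrable_const_bound[where B="\<kappa> * real i powr \<alpha>"])
     (use kern_nonneg kern_le[OF assms order_refl] in auto)

lemma average_lipschitz:
  assumes "\<And>i. 1 \<le> i \<Longrightarrow> i \<le> n \<Longrightarrow> \<bar>u i - w i\<bar> \<le> (B :: real)" and "1 \<le> n"
  shows "\<bar>(1 / real n) * (\<Sum>i=1..n. u i) - (1 / real n) * (\<Sum>i=1..n. w i)\<bar> \<le> B"
proof -
  have "\<bar>\<Sum>i=1..n. u i - w i\<bar> \<le> (\<Sum>i=1..n. \<bar>u i - w i\<bar>)" by (rule sum_abs)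
  also have "\<dots> \<le> (\<Sum>i=1..n. B)" using assms by (intro sum_mono) auto
  finally have "\<bar>\<Sum>i=1..n. u i - w i\<bar> \<le> real n * B" by simp
  then show ?thesis using assms(2)
    by (simp add: sum_subtractf abs_mult field_simps flip: diff_divide_distrib right_diff_distrib)
qed

lemma ghat_lipschitz:
  assumes "1 \<le> n"
  shows "\<bar>ghat K \<alpha> X n x \<omega> - ghat K \<alpha> X n x' \<omega>\<bar> \<le> real n ^ 2 * L * \<bar>x - x'\<bar>"
  unfolding ghat_eq by (intro average_lipschitz kern_lipschitz assms)

lemma ghat_mean_lipschitz:
  assumes "1 \<le> n"
  shows "\<bar>ghat_mean n x - ghat_mean n x'\<bar> \<le> real n ^ 2 * L * \<bar>x - x'\<bar>"
  unfolding ghat_mean_def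
proof (intro average_lipschitz assms)
  fix i assume i: "1 \<le> i" "i \<le> n"
  note int = kern_integrable[OF i(1)]
  have "\<bar>kern_mean i x - kern_mean i x'\<bar> = \<bar>expectation (\<lambda>\<omega>. kern i x (X i \<omega>) - kern i x' (X i \<omega>))\<bar>"
    unfolding kern_mean_def by (simp add: int)
  also have "\<dots> \<le> expectation (\<lambda>\<omega>. \<bar>kern i x (X i \<omega>) - kern i x' (X i \<omega>)\<bar>)"
    by (rule integral_abs_bound)
  also have "\<dots> \<le> real n ^ 2 * L * \<bar>x - x'\<bar>"
    using int by (intro integral_le_const AE_I2 kern_lipschitz i integrable_abs) auto
  finally show "\<bar>kern_mean i x - kern_mean i x'\<bar> \<le> real n ^ 2 * L * \<bar>x - x'\<bar>" .
qed

section \<open>The mean of the density estimate\<close>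

lemma kern_mean_eq:
  assumes "1 \<le> i"
  shows "kern_mean i x = (\<integral>u. K u * g (x + bw \<alpha> i * u) \<partial>lborel)"
proof -
  note h = bw_pos[OF assms]
  have "kern_mean i x = (\<integral>y. g y * kern i x y \<partial>lborel)"
    unfolding kern_mean_def by (rule distributed_integral[symmetric, OF X_dens]) (auto simp: g_nonneg)
  also have "\<dots> = \<bar>bw \<alpha> i\<bar> *\<^sub>R (\<integral>u. g (x + bw \<alpha> i * u) * kern i x (x + bw \<alpha> i * u) \<partial>lborel)"
    using h by (intro lborel_integral_real_affine) auto
  also have "\<dots> = (\<integral>u. bw \<alpha> i * (g (x + bw \<alpha> i * u) * kern i x (x + bw \<alpha> i * u)) \<partial>lborel)"
    using h by simp
  also have "\<dots> = (\<integral>u. K u * g (x + bw \<alpha> i * u) \<partial>lborel)"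
    using h by (intro Bochner_Integration.integral_cong) (auto simp: kern_def)
  finally show ?thesis .
qed

lemma K_g_integrable: "integrable lborel (\<lambda>u. K u * g (x + h * u))"
proof (rule Bochner_Integration.integrable_bound[where f="\<lambda>u. K u * G"])
  show "integrable lborel (\<lambda>u. K u * G)" using K_integrable by simp
  show "AE u in lborel. norm (K u * g (x + h * u)) \<le> norm (K u * G)"
    using K_nonneg g_nonneg g_le G_pos by (intro AE_I2) (auto simp: abs_mult intro!: mult_left_mono)
qed simp

lemma kern_mean_le:
  assumes "1 \<le> i"
  shows "kern_mean i x \<le> G"
proof -
  have "kern_mean i x \<le> (\<integral>u. K u * G \<partial>lborel)"
    unfolding kern_mean_eq[OF assms] using K_integrable K_nonneg g_le
    by (intro integral_mono K_g_integrable) (auto intro: mult_left_mono)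
  also have "\<dots> = G" using K_integral by simp
  finally show ?thesis .
qed

lemma kern_mean_nonneg: "0 \<le> kern_mean i x"
  unfolding kern_mean_def by (intro Bochner_Integration.integral_nonneg kern_nonneg)

lemma K_half_integrals:
  "(\<integral>u. indicator {0<..} u * K u \<partial>lborel) = 1/2" "(\<integral>u. indicator {..<0} u * K u \<partial>lborel) = 1/2"
proof -
  have int: "integrable lborel (\<lambda>u. indicator A u * K u)" if "A \<in> sets borel" for A
    using integrable_mult_indicator[OF _ K_integrable, of A] that by simp
  have "(\<integral>u. indicator {0<..} u * K u \<partial>lborel)
      = (\<integral>u. indicator {0<..} (0 + (-1) * u) * K (0 + (-1) * u) \<partial>lborel)"
    by (subst lborel_integral_real_affine[where c="-1" and t=0]) simp_all
  also have "\<dots> = (\<integral>u. indicator {..<0} u * K u \<partial>lborel)"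
    by (intro Bochner_Integration.integral_cong) (auto simp: K_even indicator_def)
  finally have eq: "(\<integral>u. indicator {0<..} u * K u \<partial>lborel) = (\<integral>u. indicator {..<0} u * K u \<partial>lborel)" .
  have "AE u in lborel. u \<noteq> (0 :: real)" by (rule AE_lborel_singleton)
  then have "integral\<^sup>L lborel K = (\<integral>u. indicator {0<..} u * K u + indicator {..<0} u * K u \<partial>lborel)"
    by (intro integral_cong_AE) (auto elim!: eventually_mono simp: indicator_def)
  also have "\<dots> = (\<integral>u. indicator {0<..} u * K u \<partial>lborel) + (\<integral>u. indicator {..<0} u * K u \<partial>lborel)"
    by (intro Bochner_Integration.integral_add int) auto
  finally show "(\<integral>u. indicator {0<..} u * K u \<partial>lborel) = 1/2" "(\<integral>u. indicator {..<0} u * K u \<partial>lborel) = 1/2"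
    using K_integral eq by auto
qed

text \<open>At the end points of the support only half of the kernel mass sees the density.\<close>
lemma kern_mean_ge:
  assumes i: "1 \<le> i" "2 * R * bw \<alpha> i \<le> 1" and x: "x \<in> {-1/2..1/2}"
  shows "c / 2 \<le> kern_mean i x"
proof -
  note h = bw_pos[OF i(1)]
  have bR: "bw \<alpha> i * R \<le> 1/2" using i(2) by (simp add: mult_ac)
  \<comment> \<open>A is the half line pointing from x towards the middle of the interval; a
    displacement of at most 1/2 in that direction stays inside.\<close>
  obtain A :: "real set" where A [measurable]: "A \<in> sets borel" and half: "(\<integral>u. indicator A u * K u \<partial>lborel) = 1/2"
    and inside: "\<And>u. u \<in> A \<Longrightarrow> \<bar>u\<bar> \<le> R \<Longrightarrow> x + bw \<alpha> i * u \<in> {-1/2..1/2}"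
  proof (cases "x \<le> 0")
    case True
    show ?thesis
    proof (rule that[of "{0<..}"])
      fix u assume u: "u \<in> {0<..}" "\<bar>u\<bar> \<le> R"
      have "bw \<alpha> i * u \<le> bw \<alpha> i * R" "0 \<le> bw \<alpha> i * u" using u h by (auto intro: mult_left_mono)
      then show "x + bw \<alpha> i * u \<in> {-1/2..1/2}" using x True bR unfolding atLeastAtMost_iff by linarith
    qed (auto simp: K_half_integrals)
  next
    case False
    show ?thesis
    proof (rule that[of "{..<0}"])
      fix u assume u: "u \<in> {..<0}" "\<bar>u\<bar> \<le> R"
      have "bw \<alpha> i * (- u) \<le> bw \<alpha> i * R" using u h by (intro mult_left_mono) auto
      moreover have "0 \<le> bw \<alpha> i * (- u)" using u h by (intro mult_nonneg_nonneg) auto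
      ultimately
      show "x + bw \<alpha> i * u \<in> {-1/2..1/2}" using x False bR unfolding atLeastAtMost_iff by linarith
    qed (auto simp: K_half_integrals)
  qed
  have "c / 2 = (\<integral>u. c * (indicator A u * K u) \<partial>lborel)" by (simp add: half)
  also have "\<dots> \<le> kern_mean i x"
    unfolding kern_mean_eq[OF i(1)]
  proof (rule integral_mono)
    show "integrable lborel (\<lambda>u. c * (indicator A u * K u))"
      using integrable_mult_indicator[OF _ K_integrable, of A] by simp
    fix u
    show "c * (indicator A u * K u) \<le> K u * g (x + bw \<alpha> i * u)"
    proof (cases "u \<in> A \<and> \<bar>u\<bar> \<le> R")
      case True
      then have "c \<le> g (x + bw \<alpha> i * u)" using inside by (intro g_ge) auto
      then have "c * K u \<le> g (x + bw \<alpha> i * u) * K u" using K_nonneg by (rule mult_right_mono)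
      then show ?thesis using True by (simp add: mult.commute)
    next
      case False
      then show ?thesis using K_support[of u] K_nonneg[of u] g_nonneg by (cases "u \<in> A") auto
    qed
  qed (rule K_g_integrable)
  finally show ?thesis .
qed

text \<open>\<open>kern_mean_eq\<close> moves the bandwidth into the argument of g, so continuity at
  x and the majorant \<open>K u * G\<close> allow dominated convergence.\<close>

lemma kern_mean_tendsto:
  assumes x: "x \<in> {-1/2<..<1/2}"
  shows "(\<lambda>i. kern_mean i x) \<longlonglongrightarrow> g x"
proof -
  have "(\<lambda>i. \<integral>u. K u * g (x + bw \<alpha> i * u) \<partial>lborel) \<longlonglongrightarrow> (\<integral>u. K u * g x \<partial>lborel)"
  proof (rule integral_dominated_convergence[where w="\<lambda>u. K u * G"])
    show "integrable lborel (\<lambda>u. K u * G)" using K_integrable by simp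
    show "AE u in lborel. norm (K u * g (x + bw \<alpha> i * u)) \<le> K u * G" for i
      using K_nonneg g_nonneg g_le by (intro AE_I2) (auto simp: abs_mult intro!: mult_left_mono)
    show "AE u in lborel. (\<lambda>i. K u * g (x + bw \<alpha> i * u)) \<longlonglongrightarrow> K u * g x"
    proof (intro AE_I2 tendsto_mult_left)
      fix u
      have "(\<lambda>i. x + bw \<alpha> i * u) \<longlonglongrightarrow> x + 0 * u" by (intro tendsto_intros bw_tendsto_0)
      then have "(\<lambda>i. x + bw \<alpha> i * u) \<longlonglongrightarrow> x" by simp
      then show "(\<lambda>i. g (x + bw \<alpha> i * u)) \<longlonglongrightarrow> g x"
        by (rule isCont_tendsto_compose[OF g_isCont[OF x]])
    qed
  qed auto
  also have "(\<integral>u. K u * g x \<partial>lborel) = g x" using K_integral by simp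
  finally show ?thesis
    by (rule Lim_transform_eventually)
       (use eventually_ge_at_top[of 1] in eventually_elim, simp add: kern_mean_eq)
qed

lemma ghat_mean_tendsto: "x \<in> {-1/2<..<1/2} \<Longrightarrow> (\<lambda>n. ghat_mean n x) \<longlonglongrightarrow> g x"
  unfolding ghat_mean_def by (intro Cesaro_tendsto kern_mean_tendsto)

text \<open>Beyond N the bandwidth is small enough for \<open>kern_mean_ge\<close>. Once n \<ge> 2
  (N + 1), at least half of the summands are at least c/2 and the others are nonnegative.\<close>

lemma ghat_mean_ge: "eventually (\<lambda>n. \<forall>x\<in>{-1/2..1/2}. c / 4 \<le> ghat_mean n x) sequentially"
proof -
  have "eventually (\<lambda>i. bw \<alpha> i < 1 / (2 * R)) sequentially"
    using R_pos by (intro order_tendstoD(2)[OF bw_tendsto_0]) auto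
  then obtain N where N: "\<And>i. i \<ge> N \<Longrightarrow> bw \<alpha> i < 1 / (2 * R)" unfolding eventually_sequentially by blast
  have "\<forall>x\<in>{-1/2..1/2}. c / 4 \<le> ghat_mean n x" if n: "n \<ge> 2 * Suc N" for n
  proof
    fix x :: real assume x: "x \<in> {-1/2..1/2}"
    have "real n / 2 * (c / 2) \<le> real (card {Suc N..n}) * (c / 2)"
      using n c_pos by (intro mult_right_mono) auto
    also have "\<dots> = (\<Sum>i=Suc N..n. c / 2)" by simp
    also have "\<dots> \<le> (\<Sum>i=Suc N..n. kern_mean i x)"
    proof (intro sum_mono kern_mean_ge x)
      fix i assume i: "i \<in> {Suc N..n}"
      then show "1 \<le> i" by simp
      have "bw \<alpha> i < 1 / (2 * R)" using N i by simp
      then show "2 * R * bw \<alpha> i \<le> 1" using R_pos by (simp add: field_simps)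
    qed
    also have "\<dots> \<le> (\<Sum>i=1..n. kern_mean i x)"
      by (intro sum_mono2) (auto simp: kern_mean_nonneg)
    finally show "c / 4 \<le> ghat_mean n x"
      using n by (simp add: ghat_mean_def field_simps)
  qed
  then show ?thesis unfolding eventually_sequentially by blast
qed

section \<open>Fluctuation of the density estimate about its mean\<close>

lemma ghat_measurable [measurable]: "ghat K \<alpha> X n x \<in> borel_measurable M"
  unfolding ghat_eq[abs_def] by measurable

text \<open>The Chernoff parameter is l = t / n^\<alpha> with t independent of n. The last condition
  on t keeps the quadratic term of the exponent below half of the linear one.\<close>

lemma ghat_deviation:
  assumes n: "1 \<le> n" and \<epsilon>: "0 < \<epsilon>" and t: "0 < t" "2 * t * \<kappa> \<le> 1" "t * \<kappa> * G \<le> \<epsilon> / 2"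
  shows "prob {\<omega> \<in> space M. \<epsilon> \<le> \<bar>ghat K \<alpha> X n x \<omega> - ghat_mean n x\<bar>}
    \<le> 2 * exp (- (t * \<epsilon> / 2 * real n powr (1 - \<alpha>)))"
proof -
  define P where "P = real n powr \<alpha>"
  have P: "0 < P" using n by (simp add: P_def)
  define l where "l = t / P"
  have kint: "integrable M (\<lambda>\<omega>. kern i x (X i \<omega>))" if "i \<in> {1..n}" for i
    using that by (intro kern_integrable) auto
  have sum_eq: "(\<Sum>i=1..n. kern i x (X i \<omega>) - expectation (\<lambda>\<omega>. kern i x (X i \<omega>)))
      = real n * (ghat K \<alpha> X n x \<omega> - ghat_mean n x)" for \<omega>
    using n by (simp add: ghat_eq ghat_mean_def kern_mean_def sum_subtractf right_diff_distrib)
  have "prob {\<omega> \<in> space M. real n * \<epsilon> \<le> \<bar>\<Sum>i=1..n. kern i x (X i \<omega>) - expectation (\<lambda>\<omega>. kern i x (X i \<omega>))\<bar>}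
      \<le> 2 * exp (real (card {1..n}) * l\<^sup>2 * (\<kappa> * P * G) - l * (real n * \<epsilon>))"
  proof (rule chernoff_two_sided[where b="\<kappa> * P"])
    show "indep_vars (\<lambda>_. borel) (\<lambda>i \<omega>. kern i x (X i \<omega>)) {1..n}"
      by (intro indep_vars_compose2[OF indep_vars_subset[OF X_indep]]) auto
    fix i assume i: "i \<in> {1..n}"
    have kb: "kern i x y \<le> \<kappa> * P" for y using kern_le[of i n x y] i by (simp add: P_def)
    then show "\<bar>kern i x (X i \<omega>)\<bar> \<le> \<kappa> * P" for \<omega> using kern_nonneg by simp
    \<comment> \<open>One factor of the square is bounded by the range, the other is integrated and
      contributes at most G; this saves a factor n^\<alpha>.\<close>
    have sq_le: "(kern i x y)\<^sup>2 \<le> \<kappa> * P * kern i x y" for y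
      using kb kern_nonneg unfolding power2_eq_square by (intro mult_right_mono) auto
    have "expectation (\<lambda>\<omega>. (kern i x (X i \<omega>))\<^sup>2) \<le> expectation (\<lambda>\<omega>. \<kappa> * P * kern i x (X i \<omega>))"
    proof (rule integral_mono)
      show "integrable M (\<lambda>\<omega>. (kern i x (X i \<omega>))\<^sup>2)"
        by (rule Bochner_Integration.integrable_bound[where f="\<lambda>\<omega>. \<kappa> * P * kern i x (X i \<omega>)"])
           (use kint[OF i] sq_le kern_nonneg P \<kappa>_pos in auto)
    qed (use kint[OF i] sq_le in auto)
    also have "\<dots> = \<kappa> * P * kern_mean i x" by (simp add: kern_mean_def)
    also have "\<dots> \<le> \<kappa> * P * G" using i P \<kappa>_pos by (intro mult_left_mono kern_mean_le) auto
    finally show "expectation (\<lambda>\<omega>. (kern i x (X i \<omega>))\<^sup>2) \<le> \<kappa> * P * G" .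
  next
    show "0 < l" using t P by (simp add: l_def)
    show "2 * l * (\<kappa> * P) \<le> 1" using t P by (simp add: l_def)
  qed simp
  also have "{\<omega> \<in> space M. real n * \<epsilon> \<le> \<bar>\<Sum>i=1..n. kern i x (X i \<omega>) - expectation (\<lambda>\<omega>. kern i x (X i \<omega>))\<bar>}
      = {\<omega> \<in> space M. \<epsilon> \<le> \<bar>ghat K \<alpha> X n x \<omega> - ghat_mean n x\<bar>}"
    unfolding sum_eq using n by (simp add: abs_mult)
  also have "real (card {1..n}) * l\<^sup>2 * (\<kappa> * P * G) - l * (real n * \<epsilon>) = real n / P * (t * (t * \<kappa> * G - \<epsilon>))"
    using P by (simp add: l_def field_simps power2_eq_square)
  also have "real n / P = real n powr (1 - \<alpha>)" using n by (simp add: P_def powr_diff)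
  also have "2 * exp (real n powr (1 - \<alpha>) * (t * (t * \<kappa> * G - \<epsilon>))) \<le> 2 * exp (real n powr (1 - \<alpha>) * (t * (- (\<epsilon> / 2))))"
    using t by (intro mult_left_mono iffD2[OF exp_le_cancel_iff]) auto
  finally show ?thesis by (simp add: mult_ac)
qed

text \<open>Borel-Cantelli over the n^3 + 1 grid points controls the grid; the Lipschitz bounds,
  valid on every path, carry this to all x outside a single null set.\<close>

lemma AE_ghat_uniform_deviation:
  assumes \<epsilon>: "0 < \<epsilon>"
  shows "AE \<omega> in M. eventually (\<lambda>n. \<forall>x\<in>{-1/2..1/2}. \<bar>ghat K \<alpha> X n x \<omega> - ghat_mean n x\<bar> \<le> 2 * \<epsilon>) sequentially"
proof -
  \<comment> \<open>The largest t meeting both conditions of \<open>ghat_deviation\<close>.\<close>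
  define t where "t = min (1 / (2 * \<kappa>)) (\<epsilon> / (2 * \<kappa> * G))"
  have t: "0 < t" using \<epsilon> \<kappa>_pos G_pos by (simp add: t_def)
  have "t \<le> 1 / (2 * \<kappa>)" "t \<le> \<epsilon> / (2 * \<kappa> * G)" by (simp_all add: t_def)
  then have t2: "2 * t * \<kappa> \<le> 1" "t * \<kappa> * G \<le> \<epsilon> / 2" using \<kappa>_pos G_pos by (simp_all add: field_simps)
  define pt where "pt n j = -1/2 + real j / real n ^ 3" for n j :: nat
  define A where "A n = (\<Union>j\<in>{..n^3}. {\<omega> \<in> space M. \<epsilon> \<le> \<bar>ghat K \<alpha> X n (pt n j) \<omega> - ghat_mean n (pt n j)\<bar>})" for n
  define C where "C = t * \<epsilon> / 2"
  have C: "0 < C" using t \<epsilon> by (simp add: C_def)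
  have A_le: "prob (A n) \<le> 2 * ((real n ^ 3 + 1) * exp (- (C * real n powr (1 - \<alpha>))))" if "1 \<le> n" for n
  proof -
    have "prob (A n) \<le> (\<Sum>j\<in>{..n^3}. prob {\<omega> \<in> space M. \<epsilon> \<le> \<bar>ghat K \<alpha> X n (pt n j) \<omega> - ghat_mean n (pt n j)\<bar>})"
      unfolding A_def by (intro measure_UNION_le) auto
    also have "\<dots> \<le> (\<Sum>j\<in>{..n^3}. 2 * exp (- (C * real n powr (1 - \<alpha>))))"
      unfolding C_def by (intro sum_mono ghat_deviation that \<epsilon> t t2)
    also have "\<dots> = 2 * ((real n ^ 3 + 1) * exp (- (C * real n powr (1 - \<alpha>))))"
      by (simp add: algebra_simps)
    finally show ?thesis .
  qed
  have "AE \<omega> in M. eventually (\<lambda>n. \<omega> \<in> space M - A n) sequentially"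
  proof (rule borel_cantelli_AE1)
    show "A n \<in> sets M" for n unfolding A_def by measurable
    have "summable (\<lambda>n. 2 * ((real n ^ 3 + 1) * exp (- (C * real n powr (1 - \<alpha>)))))"
      using \<alpha> C by (intro summable_mult summable_cubic_exp_powr) auto
    then show "summable (\<lambda>n. prob (A n))"
      by (rule summable_comparison_test') (use A_le in \<open>auto simp: measure_nonneg\<close>)
  qed (simp add: emeasure_eq_measure)
  then show ?thesis
  proof eventually_elim
    case (elim \<omega>)
    \<comment> \<open>From N on, passing to the grid costs at most L/n \<le> \<epsilon>/2 for the
      estimate and again for its mean; with \<epsilon> at the grid point the total is 2
      \<epsilon>.\<close>
    obtain N :: nat where N: "2 * L / \<epsilon> < real N" using reals_Archimedean2 by blast
    show ?case using elim eventually_ge_at_top[of "max 1 N"]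
    proof eventually_elim
      case (elim n)
      then have n: "1 \<le> n" "N \<le> n" by auto
      show ?case
      proof
        fix x :: real assume x: "x \<in> {-1/2..1/2}"
        \<comment> \<open>Index of the last grid point not to the right of x.\<close>
        define j where "j = nat \<lfloor>(x + 1/2) * real n ^ 3\<rfloor>"
        have nn: "0 \<le> (x + 1/2) * real n ^ 3" using x by simp
        have "(x + 1/2) * real n ^ 3 \<le> 1 * real n ^ 3" using x by (intro mult_right_mono) auto
        then have up: "(x + 1/2) * real n ^ 3 \<le> real (n ^ 3)" by simp
        have j: "real j \<le> (x + 1/2) * real n ^ 3" "(x + 1/2) * real n ^ 3 < real j + 1"
          using nn by (auto simp: j_def)
        have "real j \<le> real (n ^ 3)" using j(1) up by linarith
        then have jn: "j \<in> {..n^3}" by (simp only: of_nat_le_iff atMost_iff)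
        have n3: "0 < real n ^ 3" using n by simp
        have "x - pt n j = ((x + 1/2) * real n ^ 3 - real j) / real n ^ 3"
          using n3 by (simp add: pt_def field_simps)
        then have dist: "\<bar>x - pt n j\<bar> \<le> 1 / real n ^ 3"
          using j n3 by (simp add: divide_right_mono)
        have "real n ^ 2 * L * \<bar>x - pt n j\<bar> \<le> real n ^ 2 * L * (1 / real n ^ 3)"
          using L_nonneg by (intro mult_left_mono dist) auto
        also have "\<dots> = L / real n" using n by (simp add: power2_eq_square power3_eq_cube)
        finally have lip: "real n ^ 2 * L * \<bar>x - pt n j\<bar> \<le> L / real n" .
        have "2 * L / \<epsilon> < real n" using N n by (meson less_le_trans of_nat_mono)
        then have Ln: "2 * (L / real n) \<le> \<epsilon>" using \<epsilon> n by (simp add: field_simps)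
        have "\<bar>ghat K \<alpha> X n (pt n j) \<omega> - ghat_mean n (pt n j)\<bar> < \<epsilon>"
          using elim(1) jn unfolding A_def by (auto simp: not_le)
        then show "\<bar>ghat K \<alpha> X n x \<omega> - ghat_mean n x\<bar> \<le> 2 * \<epsilon>"
          using ghat_lipschitz[OF n(1), of x \<omega> "pt n j"] ghat_mean_lipschitz[OF n(1), of x "pt n j"] lip Ln
          by linarith
      qed
    qed
  qed
qed

lemma AE_ghat_consistent:
  "AE \<omega> in M. eventually (\<lambda>n. \<forall>x\<in>{-1/2..1/2}. c / 8 \<le> ghat K \<alpha> X n x \<omega>) sequentially \<and>
     (\<forall>x\<in>{-1/2<..<1/2}. (\<lambda>n. ghat K \<alpha> X n x \<omega>) \<longlonglongrightarrow> g x)"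
proof -
  \<comment> \<open>Countably many tolerances suffice, so the null sets can be united.\<close>
  have "AE \<omega> in M. \<forall>k::nat. eventually (\<lambda>n. \<forall>x\<in>{-1/2..1/2}.
      \<bar>ghat K \<alpha> X n x \<omega> - ghat_mean n x\<bar> \<le> 2 * (1 / real (Suc k))) sequentially"
    by (subst AE_all_countable) (intro allI AE_ghat_uniform_deviation, simp)
  then show ?thesis
  proof eventually_elim
    case (elim \<omega>)
    have dev: "eventually (\<lambda>n. \<forall>x\<in>{-1/2..1/2}. \<bar>ghat K \<alpha> X n x \<omega> - ghat_mean n x\<bar> < e) sequentially"
      if e: "0 < e" for e
    proof -
      obtain k where k: "inverse (real (Suc k)) < e / 2" using reals_Archimedean[of "e / 2"] e by auto
      moreover have "1 / real (Suc k) = inverse (real (Suc k))" by (rule inverse_eq_divide[symmetric])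
      ultimately have "2 * (1 / real (Suc k)) < e" by linarith
      with elim[rule_format, of k] show ?thesis by (auto elim!: eventually_mono)
    qed
    show ?case
    proof (intro conjI ballI)
      have "0 < c / 8" using c_pos by simp
      from dev[OF this] ghat_mean_ge
      show "eventually (\<lambda>n. \<forall>x\<in>{-1/2..1/2}. c / 8 \<le> ghat K \<alpha> X n x \<omega>) sequentially"
      proof eventually_elim
        case (elim n)
        show ?case
        proof
          fix x :: real assume "x \<in> {-1/2..1/2}"
          with elim have "\<bar>ghat K \<alpha> X n x \<omega> - ghat_mean n x\<bar> < c / 8" "c / 4 \<le> ghat_mean n x" by auto
          then show "c / 8 \<le> ghat K \<alpha> X n x \<omega>" by linarith
        qed
      qed
      fix x :: real assume x: "x \<in> {-1/2<..<1/2}"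
      have "(\<lambda>n. ghat K \<alpha> X n x \<omega> - ghat_mean n x) \<longlonglongrightarrow> 0"
      proof (rule tendstoI)
        fix e :: real assume "0 < e"
        from dev[OF this] show "eventually (\<lambda>n. dist (ghat K \<alpha> X n x \<omega> - ghat_mean n x) 0 < e) sequentially"
          using x by (auto elim!: eventually_mono)
      qed
      from tendsto_add[OF this ghat_mean_tendsto[OF x]]
      show "(\<lambda>n. ghat K \<alpha> X n x \<omega>) \<longlonglongrightarrow> g x" by simp
    qed
  qed
qed

end

section \<open>The projected estimator\<close>

locale projected_regression = kernel_density M X g K \<alpha> c G \<kappa> L R
  for M :: "'a measure" and X g K \<alpha> c G \<kappa> L R +
  fixes eps :: "nat \<Rightarrow> 'a \<Rightarrow> real" and f :: "real \<Rightarrow> real" and \<theta> \<theta>1 F v :: real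
  assumes W_indep: "indep_vars (\<lambda>_. borel)
      (\<lambda>i. case i of Inl n \<Rightarrow> X n | Inr n \<Rightarrow> eps n) (UNIV :: (nat + nat) set)"
    and eps_sq_integrable: "\<And>n. integrable M (\<lambda>\<omega>. (eps n \<omega>)\<^sup>2)"
    and eps_sq_le: "\<And>n. expectation (\<lambda>\<omega>. (eps n \<omega>)\<^sup>2) \<le> v"
    and eps_mean_0: "\<And>n. expectation (eps n) = 0"
    and g_zero: "\<And>x. x \<notin> {-1/2..1/2} \<Longrightarrow> g x = 0"
    and f_measurable [measurable]: "f \<in> borel_measurable borel"
    and f_le: "\<And>x. \<bar>f x\<bar> \<le> F"
    and f_even: "\<And>x. f (- x) = f x" and f_periodic: "\<And>x. f (x + 1) = f x"
    and f1_nonzero: "fourier1 f \<noteq> 0"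
    and \<theta>1: "\<theta>1 \<in> {-1/4..1/4}" and \<theta>: "\<bar>\<theta>\<bar> < 1/4"
begin

text \<open>The algorithm is run on paths \<open>p\<close>, with \<open>p (Inl n)\<close> in the role of \<open>X\<^sub>n\<close> and \<open>p (Inr n)\<close>
  in that of \<open>\<epsilon>\<^sub>n\<close>, so that dependence on the past becomes dependence on finitely many coordinates.\<close>

definition W :: "nat + nat \<Rightarrow> 'a \<Rightarrow> real" where
  "W i = (case i of Inl n \<Rightarrow> X n | Inr n \<Rightarrow> eps n)"

definition path :: "'a \<Rightarrow> nat + nat \<Rightarrow> real" where
  "path \<omega> = (\<lambda>i. W i \<omega>)"

definition gh :: "nat \<Rightarrow> real \<Rightarrow> (nat + nat \<Rightarrow> real) \<Rightarrow> real" where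
  "gh n x p = ghat K \<alpha> (\<lambda>n p. p (Inl n)) n x p"

definition th :: "nat \<Rightarrow> (nat + nat \<Rightarrow> real) \<Rightarrow> real" where
  "th n p = thetahat K \<alpha> (sgn (fourier1 f)) (\<lambda>n p. p (Inl n))
     (Yreg f \<theta> (\<lambda>n p. p (Inl n)) (\<lambda>n p. p (Inr n))) \<theta>1 n p"

abbreviation estimate :: "nat \<Rightarrow> 'a \<Rightarrow> real" where
  "estimate n \<omega> \<equiv> thetahat K \<alpha> (sgn (fourier1 f)) X (Yreg f \<theta> X eps) \<theta>1 n \<omega>"

lemma W_simps [simp]: "W (Inl n) = X n" "W (Inr n) = eps n"
  by (simp_all add: W_def)

lemma path_simps [simp]: "path \<omega> (Inl n) = X n \<omega>" "path \<omega> (Inr n) = eps n \<omega>"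
  by (simp_all add: path_def)

lemma W_indep': "indep_vars (\<lambda>_. borel) W UNIV"
  using W_indep by (simp add: W_def[abs_def])

lemma W_measurable [measurable]: "W i \<in> borel_measurable M"
  using W_indep' by (auto simp: indep_vars_def)

lemma eps_measurable [measurable]: "eps n \<in> borel_measurable M"
  using W_measurable[of "Inr n"] by simp

lemma F_nonneg: "0 \<le> F"
  using f_le[of 0] by linarith

lemma gh_path: "gh n x (path \<omega>) = ghat K \<alpha> X n x \<omega>"
  by (simp add: gh_def ghat_def)

lemma th_Suc: "th (Suc n) p = (if n = 0 then \<theta>1 else projC (th n p + sgn (fourier1 f) * (1 / real (Suc n)) *
    (sin (2 * pi * (p (Inl (Suc n)) - th n p)) / gh n (p (Inl (Suc n))) p
      * (f (p (Inl (Suc n)) - \<theta>) + p (Inr (Suc n))))))"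
  by (simp add: th_def gh_def Tstat_def Yreg_def)

lemma th_0: "th 0 p = \<theta>1"
  by (simp add: th_def)

lemma th_path: "th n (path \<omega>) = estimate n \<omega>"
proof (induction n)
  case (Suc n)
  then show ?case by (simp add: th_Suc gh_path Tstat_def Yreg_def)
qed (simp add: th_0)

lemma estimate_range: "estimate n \<omega> \<in> {-1/4..1/4}"
proof (cases n)
  case (Suc m)
  then show ?thesis using \<theta>1 projC_range by (cases "m = 0") (simp_all del: atLeastAtMost_iff)
qed (use \<theta>1 in simp)

lemma gh_cong: "(\<And>i. i \<le> n \<Longrightarrow> p (Inl i) = q (Inl i)) \<Longrightarrow> gh n x p = gh n x q"
  unfolding gh_def ghat_def by (intro arg_cong[where f="\<lambda>t. 1 / real n * t"] sum.cong) auto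

lemma th_cong: "(\<And>i. i \<le> n \<Longrightarrow> p (Inl i) = q (Inl i)) \<Longrightarrow> (\<And>i. i \<le> n \<Longrightarrow> p (Inr i) = q (Inr i)) \<Longrightarrow>
    th n p = th n q"
proof (induction n)
  case (Suc n)
  have "th n p = th n q" using Suc.prems by (intro Suc.IH) auto
  moreover have "gh n x p = gh n x q" for x using Suc.prems by (intro gh_cong) auto
  ultimately show ?case using Suc.prems by (simp add: th_Suc)
qed (simp add: th_0)

lemma gh_measurable [measurable (raw)]:
  assumes [measurable]: "h \<in> borel_measurable N" "q \<in> N \<rightarrow>\<^sub>M path_space"
  shows "(\<lambda>w. gh n (h w) (q w)) \<in> borel_measurable N"
  unfolding gh_def ghat_def by measurable

lemma projC_measurable [measurable]: "projC \<in> borel_measurable borel"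
  unfolding projC_def by measurable

lemma th_measurable [measurable]: "th n \<in> borel_measurable path_space"
proof (induction n)
  case 0
  then show ?case by (simp add: th_0[abs_def])
next
  case (Suc n)
  note [measurable] = this
  show ?case unfolding th_Suc[abs_def] by measurable
qed

text \<open>Flooring the denominator at \<open>c/8\<close> makes the noise square integrable; along almost every
  path it eventually changes nothing.\<close>
definition wgt :: "nat \<Rightarrow> (nat + nat \<Rightarrow> real) \<Rightarrow> real \<Rightarrow> real" where
  "wgt n p x = sin (2 * pi * (x - th n p)) / max (c / 8) (gh n x p)"

text \<open>The conditional mean of the floored step given the path up to n: the path is frozen and
  a fresh design point is integrated against g. The error contributes nothing, being
  centred.\<close>

definition drift :: "nat \<Rightarrow> (nat + nat \<Rightarrow> real) \<Rightarrow> real" where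
  "drift n p = (\<integral>y. g y * (wgt n p y * f (y - \<theta>)) \<partial>lborel)"

lemma wgt_measurable [measurable (raw)]:
  assumes [measurable]: "h \<in> borel_measurable N" "q \<in> N \<rightarrow>\<^sub>M path_space"
  shows "(\<lambda>w. wgt n (q w) (h w)) \<in> borel_measurable N"
  unfolding wgt_def by measurable

lemma wgt_section_measurable [measurable]: "wgt n p \<in> borel_measurable borel"
  by (rule wgt_measurable[OF measurable_ident_sets[OF refl], of "\<lambda>_. p"]) (simp add: space_PiM)

lemma drift_measurable [measurable]: "drift n \<in> borel_measurable path_space"
  unfolding drift_def by measurable

lemma wgt_le: "\<bar>wgt n p x\<bar> \<le> 8 / c"
proof -
  have "\<bar>wgt n p x\<bar> \<le> 1 / (c / 8)"
    unfolding wgt_def abs_divide using c_pos by (intro frac_le) auto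
  then show ?thesis by simp
qed

lemma wgt_f_le: "\<bar>wgt n p x * f y\<bar> \<le> 8 / c * F"
  unfolding abs_mult using c_pos by (intro mult_mono wgt_le f_le) auto

text \<open>Any m will do, since all \<open>X m\<close> have density g; the noise argument needs m =
  Suc n.\<close>

lemma drift_eq: "drift n p = expectation (\<lambda>\<omega>. wgt n p (X m \<omega>) * f (X m \<omega> - \<theta>))"
  unfolding drift_def by (rule distributed_integral[OF X_dens]) (auto simp: g_nonneg)

lemma wgt_f_integrable: "integrable M (\<lambda>\<omega>. wgt n p (X m \<omega>) * f (X m \<omega> - \<theta>))"
  by (rule integrable_const_bound[where B="8 / c * F"]) (use wgt_f_le in auto)

lemma drift_le: "\<bar>drift n p\<bar> \<le> 8 / c * F"
proof -
  have "\<bar>drift n p\<bar> \<le> expectation (\<lambda>\<omega>. \<bar>wgt n p (X 0 \<omega>) * f (X 0 \<omega> - \<theta>)\<bar>)"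
    unfolding drift_eq[of n p 0] by (rule integral_abs_bound)
  also have "\<dots> \<le> 8 / c * F"
    by (intro integral_le_const AE_I2 wgt_f_le integrable_abs wgt_f_integrable)
  finally show ?thesis .
qed

section \<open>Convergence of the two noise series\<close>

lemma AE_X_range: "AE \<omega> in M. X n \<omega> \<in> {-1/2..1/2}"
proof -
  have "AE x in lborel. 0 < ennreal (g x) \<longrightarrow> x \<in> {-1/2..1/2}"
    using g_zero by (intro AE_I2) force
  then show ?thesis by (subst distributed_AE2[OF X_dens]) auto
qed

text \<open>Adaptedness in coordinates; it supplies the hypothesis \<open>dep\<close> for both noise
  series.\<close>

lemma wgt_cong:
  assumes "\<And>i. i \<le> n \<Longrightarrow> p (Inl i) = q (Inl i)" "\<And>i. i \<le> n \<Longrightarrow> p (Inr i) = q (Inr i)"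
  shows "wgt n p x = wgt n q x"
  using th_cong[OF assms] gh_cong[of n p q x, OF assms(1)] by (simp add: wgt_def)

lemma AE_design_noise_convergent:
  "AE \<omega> in M. convergent (\<lambda>n. \<Sum>k<n.
     (wgt k (path \<omega>) (X (Suc k) \<omega>) * f (X (Suc k) \<omega> - \<theta>) - drift k (path \<omega>)) / real (Suc k))"
proof -
  \<comment> \<open>The fresh coordinate is \<open>Inl (Suc n)\<close>; everything of index at most
    n is past.\<close>
  define J where "J n = Inl ` {..n} \<union> Inr ` {..n}" for n :: nat
  define \<Phi> where "\<Phi> n q = (case q of (p, z) \<Rightarrow> wgt n p z * f (z - \<theta>) - drift n p)" for n q
  have "AE \<omega> in M. convergent (\<lambda>n. \<Sum>k<n. \<Phi> k (\<lambda>i. W i \<omega>, W (Inl (Suc k)) \<omega>) / real (Suc k))"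
  proof (rule noise_series_AE_convergent[OF W_indep', where J=J and B="2 * (8 / c * F)" and v=1])
    show "Inl (Suc n) \<notin> J n" for n by (auto simp: J_def)
    show "insert (Inl (Suc m)) (J m) \<subseteq> J n" if "m < n" for m n using that by (auto simp: J_def)
    show "\<Phi> n \<in> borel_measurable (path_space \<Otimes>\<^sub>M borel)" for n unfolding \<Phi>_def by measurable
    show "\<Phi> n (cut (J n) p, z) = \<Phi> n (p, z)" for n p z
    proof -
      have "wgt n (cut (J n) p) x = wgt n p x" for x by (rule wgt_cong) (auto simp: J_def)
      then show ?thesis by (simp add: \<Phi>_def drift_def)
    qed
    show "\<bar>\<Phi> n (p, z)\<bar> \<le> 2 * (8 / c * F) * (1 + \<bar>z\<bar>)" for n p z
    proof -
      have nn: "0 \<le> 8 / c * F" using c_pos F_nonneg by simp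
      have "\<bar>\<Phi> n (p, z)\<bar> \<le> 2 * (8 / c * F)"
        using wgt_f_le[of n p z "z - \<theta>"] drift_le[of n p] unfolding \<Phi>_def prod.case by linarith
      also have "\<dots> \<le> 2 * (8 / c * F) * (1 + \<bar>z\<bar>)"
        using mult_left_mono[of 1 "1 + \<bar>z\<bar>" "2 * (8 / c * F)"] nn by simp
      finally show ?thesis .
    qed
    have AE1: "AE \<omega> in M. (X n \<omega>)\<^sup>2 \<le> 1" for n
      using AE_X_range[of n] by eventually_elim (auto simp: abs_square_le_1)
    show int: "integrable M (\<lambda>\<omega>. (W (Inl (Suc n)) \<omega>)\<^sup>2)" for n
      by (rule integrable_const_bound[where B=1]) (use AE1 in auto)
    show "expectation (\<lambda>\<omega>. (W (Inl (Suc n)) \<omega>)\<^sup>2) \<le> 1" for n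
      using int[of n] AE1 by (intro integral_le_const) auto
    show "(\<integral>z. \<Phi> n (p, z) \<partial>distr M borel (W (Inl (Suc n)))) = 0" for n p
    proof -
      have "(\<integral>z. \<Phi> n (p, z) \<partial>distr M borel (W (Inl (Suc n))))
          = expectation (\<lambda>\<omega>. wgt n p (X (Suc n) \<omega>) * f (X (Suc n) \<omega> - \<theta>) - drift n p)"
        unfolding \<Phi>_def prod.case by (subst integral_distr) auto
      also have "\<dots> = 0"
        using wgt_f_integrable[of n p "Suc n"] by (simp add: drift_eq[of n p "Suc n"] prob_space)
      finally show ?thesis .
    qed
  qed
  then show ?thesis by (simp add: \<Phi>_def path_def)
qed

text \<open>The weight is bounded but the error is not; this series is the reason why the general
  noise bound grows linearly in z.\<close>

lemma AE_error_noise_convergent: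
  "AE \<omega> in M. convergent (\<lambda>n. \<Sum>k<n. wgt k (path \<omega>) (X (Suc k) \<omega>) * eps (Suc k) \<omega> / real (Suc k))"
proof -
  \<comment> \<open>Unlike for the design noise, \<open>Inl (Suc n)\<close> belongs to the past: the
    weight is evaluated at that point before the error is averaged.\<close>
  define J where "J n = Inl ` {..Suc n} \<union> Inr ` {..n}" for n :: nat
  define \<Phi> where "\<Phi> n q = (case q of (p, z) \<Rightarrow> wgt n p (p (Inl (Suc n))) * z)" for n and q :: "(nat + nat \<Rightarrow> real) \<times> real"
  have "AE \<omega> in M. convergent (\<lambda>n. \<Sum>k<n. \<Phi> k (\<lambda>i. W i \<omega>, W (Inr (Suc k)) \<omega>) / real (Suc k))"
  proof (rule noise_series_AE_convergent[OF W_indep', where J=J and B="8 / c" and v=v])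
    show "Inr (Suc n) \<notin> J n" for n by (auto simp: J_def)
    show "insert (Inr (Suc m)) (J m) \<subseteq> J n" if "m < n" for m n using that by (auto simp: J_def)
    show "\<Phi> n \<in> borel_measurable (path_space \<Otimes>\<^sub>M borel)" for n unfolding \<Phi>_def by measurable
    show "\<Phi> n (cut (J n) p, z) = \<Phi> n (p, z)" for n p z
    proof -
      have "wgt n (cut (J n) p) x = wgt n p x" for x by (rule wgt_cong) (auto simp: J_def)
      moreover have "cut (J n) p (Inl (Suc n)) = p (Inl (Suc n))" by (auto simp: J_def)
      ultimately show ?thesis by (simp add: \<Phi>_def)
    qed
    show "\<bar>\<Phi> n (p, z)\<bar> \<le> 8 / c * (1 + \<bar>z\<bar>)" for n p z
      unfolding \<Phi>_def prod.case abs_mult using c_pos by (intro mult_mono wgt_le) auto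
    show "integrable M (\<lambda>\<omega>. (W (Inr (Suc n)) \<omega>)\<^sup>2)" for n using eps_sq_integrable by simp
    show "expectation (\<lambda>\<omega>. (W (Inr (Suc n)) \<omega>)\<^sup>2) \<le> v" for n using eps_sq_le by simp
    show "(\<integral>z. \<Phi> n (p, z) \<partial>distr M borel (W (Inr (Suc n)))) = 0" for n p
      unfolding \<Phi>_def prod.case by (subst integral_distr) (auto simp: eps_mean_0)
  qed
  then show ?thesis by (simp add: \<Phi>_def path_def)
qed

text \<open>The ratio of g to its estimate tends to 1, which turns the drift into the integral of
  \<open>fourier1_sin_convolution\<close>. The integrand itself has no pointwise limit to pass to,
  since the estimate inside the sine moves with n; the difference is therefore bounded by
  \<open>err\<close>, which is free of it.\<close>

lemma drift_tendsto:
  assumes lim: "\<And>x. x \<in> {-1/2<..<1/2} \<Longrightarrow> (\<lambda>n. ghat K \<alpha> X n x \<omega>) \<longlonglongrightarrow> g x"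
  shows "(\<lambda>n. drift n (path \<omega>) - fourier1 f * sin (2 * pi * (\<theta> - estimate n \<omega>))) \<longlonglongrightarrow> 0"
proof -
  define I :: "real set" where "I = {-1/2..1/2}"
  have [measurable]: "I \<in> sets borel" by (simp add: I_def)
  have [measurable]: "(\<lambda>x. ghat K \<alpha> X n x \<omega>) \<in> borel_measurable borel" for n
    unfolding ghat_def by measurable
  define err where "err n y = indicator I y * (F * \<bar>g y / max (c / 8) (ghat K \<alpha> X n y \<omega>) - 1\<bar>)" for n y
  have [measurable]: "err n \<in> borel_measurable borel" for n unfolding err_def by measurable
  have ratio_le: "g y / max (c / 8) z \<le> G * 8 / c" "0 \<le> g y / max (c / 8) z" for y z
  proof -
    have "g y / max (c / 8) z \<le> G / (c / 8)" using c_pos g_le[of y] G_pos by (intro frac_le) auto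
    then show "g y / max (c / 8) z \<le> G * 8 / c" by simp
    show "0 \<le> g y / max (c / 8) z" using c_pos g_nonneg[of y] by simp
  qed
  define D where "D = F * (G * 8 / c + 1)"
  have int_D: "integrable lborel (\<lambda>y. indicator I y * D)"
    unfolding I_def by (intro integrable_mult_left integrable_real_indicator) (auto simp: emeasure_lborel_Icc_eq)
  have err_le: "norm (err n y) \<le> indicator I y * D" for n y
  proof -
    have "\<bar>g y / max (c / 8) (ghat K \<alpha> X n y \<omega>) - 1\<bar> \<le> G * 8 / c + 1"
      using ratio_le[of y "ghat K \<alpha> X n y \<omega>"] by linarith
    then have "F * \<bar>g y / max (c / 8) (ghat K \<alpha> X n y \<omega>) - 1\<bar> \<le> D"
      unfolding D_def using F_nonneg by (rule mult_left_mono)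
    then show ?thesis using F_nonneg by (auto simp: err_def indicator_def)
  qed
  have "(\<lambda>n. \<integral>y. err n y \<partial>lborel) \<longlonglongrightarrow> (\<integral>(y::real). 0 \<partial>lborel)"
  proof (rule integral_dominated_convergence[where w="\<lambda>y. indicator I y * D"])
    show "integrable lborel (\<lambda>y. indicator I y * D)" by (rule int_D)
    \<comment> \<open>Consistency is available in the open interval only; the two end points are
      null.\<close>
    have "AE y in lborel. y \<noteq> (1/2 :: real)" "AE y in lborel. y \<noteq> (-1/2 :: real)"
      by (rule AE_lborel_singleton)+
    then show "AE y in lborel. (\<lambda>n. err n y) \<longlonglongrightarrow> 0"
    proof eventually_elim
      case (elim y)
      show ?case
      proof (cases "y \<in> I")
        case True
        then have y: "y \<in> {-1/2<..<1/2}" using elim by (auto simp: I_def)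
        have gy: "c \<le> g y" using True by (intro g_ge) (simp add: I_def)
        have "(\<lambda>n. indicator I y * (F * \<bar>g y / max (c / 8) (ghat K \<alpha> X n y \<omega>) - 1\<bar>))
            \<longlonglongrightarrow> indicator I y * (F * \<bar>g y / max (c / 8) (g y) - 1\<bar>)"
          using c_pos by (intro tendsto_intros lim[OF y]) auto
        moreover have "max (c / 8) (g y) = g y" using gy c_pos by simp
        ultimately show ?thesis using gy c_pos by (simp add: err_def)
      qed (simp add: err_def)
    qed
    show "AE y in lborel. norm (err n y) \<le> indicator I y * D" for n using err_le by simp
  qed auto
  then have err_lim: "(\<lambda>n. \<integral>y. err n y \<partial>lborel) \<longlonglongrightarrow> 0" by simp
  have "\<bar>drift n (path \<omega>) - fourier1 f * sin (2 * pi * (\<theta> - estimate n \<omega>))\<bar> \<le> (\<integral>y. err n y \<partial>lborel)" for n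
  proof -
    define s where "s y = sin (2 * pi * (y - estimate n \<omega>))" for y
    have [measurable]: "s \<in> borel_measurable borel" unfolding s_def by measurable
    have four: "fourier1 f * sin (2 * pi * (\<theta> - estimate n \<omega>)) = (\<integral>y. indicator I y * (s y * f (y - \<theta>)) \<partial>lborel)"
      using fourier1_sin_convolution[OF f_measurable f_le f_even f_periodic, of \<theta> "estimate n \<omega>"] \<theta>
      by (simp add: set_lebesgue_integral_def I_def s_def)
    have sf: "\<bar>s y * f (y - \<theta>)\<bar> \<le> F" for y
      using mult_mono[OF abs_sin_le_one[of "2 * pi * (y - estimate n \<omega>)"] f_le[of "y - \<theta>"]]
      by (simp add: s_def abs_mult)
    have int2: "integrable lborel (\<lambda>y. indicator I y * (s y * f (y - \<theta>)))"
      by (rule integrable_interval_bounded[where a="-1/2" and b="1/2" and B=F]) (use sf in \<open>auto simp: I_def\<close>)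
    \<comment> \<open>Isolates the ratio; outside I both sides vanish because g does.\<close>
    have eq1: "g y * (wgt n (path \<omega>) y * f (y - \<theta>))
        = indicator I y * (s y * f (y - \<theta>)) * (g y / max (c / 8) (ghat K \<alpha> X n y \<omega>))" for y
    proof (cases "y \<in> I")
      case True
      then show ?thesis by (simp add: wgt_def gh_path th_path s_def)
    next
      case False
      then have "g y = 0" by (intro g_zero) (simp add: I_def)
      then show ?thesis using False by simp
    qed
    have int1: "integrable lborel (\<lambda>y. g y * (wgt n (path \<omega>) y * f (y - \<theta>)))"
    proof (rule Bochner_Integration.integrable_bound[OF integrable_mult_left[OF int2, of "G * 8 / c"]])
      have "\<bar>a * r\<bar> \<le> \<bar>a * (G * 8 / c)\<bar>" if "0 \<le> r" "r \<le> G * 8 / c" for a r :: real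
      proof -
        have "\<bar>r\<bar> \<le> \<bar>G * 8 / c\<bar>" using that abs_ge_self[of "G * 8 / c"] by linarith
        then show ?thesis unfolding abs_mult by (rule mult_left_mono) simp
      qed
      then show "AE y in lborel. norm (g y * (wgt n (path \<omega>) y * f (y - \<theta>)))
          \<le> norm (indicator I y * (s y * f (y - \<theta>)) * (G * 8 / c))"
        unfolding eq1 real_norm_def using ratio_le by (intro AE_I2) blast
    qed simp
    have "\<bar>drift n (path \<omega>) - fourier1 f * sin (2 * pi * (\<theta> - estimate n \<omega>))\<bar>
        = \<bar>\<integral>y. g y * (wgt n (path \<omega>) y * f (y - \<theta>)) - indicator I y * (s y * f (y - \<theta>)) \<partial>lborel\<bar>"
      unfolding four drift_def by (subst Bochner_Integration.integral_diff[OF int1 int2]) simp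
    also have "\<dots> \<le> (\<integral>y. \<bar>g y * (wgt n (path \<omega>) y * f (y - \<theta>)) - indicator I y * (s y * f (y - \<theta>))\<bar> \<partial>lborel)"
      by (rule integral_abs_bound)
    also have "\<dots> \<le> (\<integral>y. err n y \<partial>lborel)"
    proof (rule integral_mono)
      show "integrable lborel (\<lambda>y. \<bar>g y * (wgt n (path \<omega>) y * f (y - \<theta>)) - indicator I y * (s y * f (y - \<theta>))\<bar>)"
        using int1 int2 by auto
      show "integrable lborel (err n)"
        by (rule Bochner_Integration.integrable_bound[OF int_D]) (auto intro!: AE_I2 order_trans[OF err_le[unfolded real_norm_def] abs_ge_self])
      fix y
      have "g y * (wgt n (path \<omega>) y * f (y - \<theta>)) - indicator I y * (s y * f (y - \<theta>))
          = indicator I y * ((s y * f (y - \<theta>)) * (g y / max (c / 8) (ghat K \<alpha> X n y \<omega>) - 1))"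
        unfolding eq1 by (simp add: algebra_simps)
      also have "\<bar>\<dots>\<bar> \<le> err n y"
        unfolding err_def abs_mult using sf[of y] F_nonneg by (intro mult_mono) (auto simp: abs_mult)
      finally show "\<bar>g y * (wgt n (path \<omega>) y * f (y - \<theta>)) - indicator I y * (s y * f (y - \<theta>))\<bar> \<le> err n y" .
    qed
    finally show ?thesis .
  qed
  then show ?thesis by (intro Lim_null_comparison[OF _ err_lim] always_eventually) simp
qed

text \<open>Purely deterministic: a single path on which all the almost sure events hold.\<close>

lemma estimate_converges:
  assumes lim: "\<And>x. x \<in> {-1/2<..<1/2} \<Longrightarrow> (\<lambda>n. ghat K \<alpha> X n x \<omega>) \<longlonglongrightarrow> g x"
    and low: "eventually (\<lambda>n. \<forall>x\<in>{-1/2..1/2}. c / 8 \<le> ghat K \<alpha> X n x \<omega>) sequentially"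
    and range: "\<And>n. X n \<omega> \<in> {-1/2..1/2}"
    and conv1: "convergent (\<lambda>n. \<Sum>k<n.
     (wgt k (path \<omega>) (X (Suc k) \<omega>) * f (X (Suc k) \<omega> - \<theta>) - drift k (path \<omega>)) / real (Suc k))"
    and conv2: "convergent (\<lambda>n. \<Sum>k<n. wgt k (path \<omega>) (X (Suc k) \<omega>) * eps (Suc k) \<omega> / real (Suc k))"
  shows "(\<lambda>n. estimate n \<omega>) \<longlonglongrightarrow> \<theta>"
    and "finite {n. n \<ge> 1 \<and> prestep K \<alpha> (sgn (fourier1 f)) X (Yreg f \<theta> X eps) \<theta>1 n \<omega> \<notin> {-1/4..1/4}}"
proof -
  define s where "s = sgn (fourier1 f)"
  define a where "a = \<bar>fourier1 f\<bar>"
  define \<gamma> where "\<gamma> n = 1 / real (Suc n)" for n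
  define x where "x n = estimate n \<omega>" for n
  \<comment> \<open>The sign of f1 is put into the noise and the bias, so that the drift coefficient
    becomes a = |f1| > 0.\<close>
  define S where "S n = s * ((\<Sum>k<n. (wgt k (path \<omega>) (X (Suc k) \<omega>) * f (X (Suc k) \<omega> - \<theta>) - drift k (path \<omega>)) / real (Suc k))
     + (\<Sum>k<n. wgt k (path \<omega>) (X (Suc k) \<omega>) * eps (Suc k) \<omega> / real (Suc k)))" for n
  define r where "r n = s * (drift n (path \<omega>) - fourier1 f * sin (2 * pi * (\<theta> - x n)))" for n
  define u where "u n = x n + \<gamma> n * (a * sin (2 * pi * (\<theta> - x n)) + r n) + (S (Suc n) - S n)" for n
  have "convergent S" unfolding S_def by (intro convergent_mult convergent_const convergent_add conv1 conv2)
  then obtain l where S: "S \<longlonglongrightarrow> l" by (auto simp: convergent_def)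
  have r: "r \<longlonglongrightarrow> 0"
    unfolding r_def x_def using tendsto_mult_right_zero[OF drift_tendsto[OF lim]] by simp
  have gam: "\<gamma> \<longlonglongrightarrow> 0" "\<And>n. 0 \<le> \<gamma> n"
    unfolding \<gamma>_def using LIMSEQ_inverse_real_of_nat by (simp_all add: inverse_eq_divide)
  have "\<not> summable (\<lambda>n. inverse (real n))" using not_summable_harmonic[where 'a=real] by (simp add: inverse_eq_divide)
  then have ns: "\<not> summable \<gamma>"
    using summable_Suc_iff[of "\<lambda>n. inverse (real n)"] by (simp add: \<gamma>_def[abs_def] inverse_eq_divide)
  have sf: "s * fourier1 f = a" by (simp add: s_def a_def sgn_mult_abs mult_sgn_abs abs_sgn mult.commute)
  \<comment> \<open>Holds from the index on at which the density estimate exceeds the floor, so that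
    the floored and the actual step agree.\<close>
  have pre: "eventually (\<lambda>n. prestep K \<alpha> s X (Yreg f \<theta> X eps) \<theta>1 n \<omega> = u n) sequentially"
    using low
  proof eventually_elim
    case (elim n)
    have "max (c / 8) (ghat K \<alpha> X n (X (Suc n) \<omega>) \<omega>) = ghat K \<alpha> X n (X (Suc n) \<omega>) \<omega>"
      using elim range[of "Suc n"] by (simp add: max_def)
    then have T: "Tstat K \<alpha> X (Yreg f \<theta> X eps) n (x n) \<omega>
        = wgt n (path \<omega>) (X (Suc n) \<omega>) * (f (X (Suc n) \<omega> - \<theta>) + eps (Suc n) \<omega>)"
      by (simp add: Tstat_def wgt_def gh_path th_path Yreg_def x_def)
    define w where "w = wgt n (path \<omega>) (X (Suc n) \<omega>)"
    have dS: "S (Suc n) - S n = \<gamma> n * (s * (w * f (X (Suc n) \<omega> - \<theta>) - drift n (path \<omega>)) + s * (w * eps (Suc n) \<omega>))"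
      by (simp add: S_def \<gamma>_def w_def algebra_simps add_divide_distrib diff_divide_distrib)
    have ar: "a * sin (2 * pi * (\<theta> - x n)) + r n = s * drift n (path \<omega>)"
      unfolding r_def sf[symmetric] by (simp add: algebra_simps)
    have "prestep K \<alpha> s X (Yreg f \<theta> X eps) \<theta>1 n \<omega> = x n + s * \<gamma> n * (w * (f (X (Suc n) \<omega> - \<theta>) + eps (Suc n) \<omega>))"
      using T by (simp add: prestep_def s_def x_def \<gamma>_def w_def)
    also have "\<dots> = u n" unfolding u_def dS ar by (simp add: algebra_simps)
    finally show ?case .
  qed
  \<comment> \<open>Index 0 is excluded: \<open>thetahat\<close> at \<open>Suc 0\<close> is the
    initial value, not a projected step.\<close>
  have rec: "eventually (\<lambda>n. x (Suc n) = projC (u n)) sequentially"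
    using pre eventually_ge_at_top[of 1]
  proof eventually_elim
    case (elim n)
    then show ?case by (simp add: x_def s_def prestep_def)
  qed
  have x_lim: "x \<longlonglongrightarrow> \<theta>"
  proof (rule projected_recursion_tendsto[OF S gam(2) ns gam(1) r _ \<theta>])
    show "0 < a" using f1_nonzero by (simp add: a_def)
    show "x n \<in> {-1/4..1/4}" for n unfolding x_def by (rule estimate_range)
  qed (use rec in \<open>simp add: u_def\<close>)
  then show "(\<lambda>n. estimate n \<omega>) \<longlonglongrightarrow> \<theta>" by (simp add: x_def[abs_def])
  \<comment> \<open>The unprojected iterate has the same limit, as its step sizes and noise
    increments vanish; the limit lies inside C, so only finitely many projections act.\<close>
  have "u \<longlonglongrightarrow> \<theta> + 0 * (a * sin (2 * pi * (\<theta> - \<theta>)) + 0) + (l - l)"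
    unfolding u_def by (intro tendsto_intros x_lim gam r LIMSEQ_Suc S)
  then have "u \<longlonglongrightarrow> \<theta>" by simp
  moreover have "-1/4 < \<theta>" "\<theta> < 1/4" using \<theta> by linarith+
  ultimately have "eventually (\<lambda>n. -1/4 < u n) sequentially" "eventually (\<lambda>n. u n < 1/4) sequentially"
    by (blast intro: order_tendstoD)+
  with pre have "eventually (\<lambda>n. prestep K \<alpha> s X (Yreg f \<theta> X eps) \<theta>1 n \<omega> \<in> {-1/4..1/4}) sequentially"
    by eventually_elim simp
  then obtain N where "\<And>n. n \<ge> N \<Longrightarrow> prestep K \<alpha> s X (Yreg f \<theta> X eps) \<theta>1 n \<omega> \<in> {-1/4..1/4}"
    unfolding eventually_sequentially by blast
  then have "{n. n \<ge> 1 \<and> prestep K \<alpha> s X (Yreg f \<theta> X eps) \<theta>1 n \<omega> \<notin> {-1/4..1/4}} \<subseteq> {..<N}"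
    by (auto simp: not_le[symmetric] simp del: atLeastAtMost_iff)
  then show "finite {n. n \<ge> 1 \<and> prestep K \<alpha> (sgn (fourier1 f)) X (Yreg f \<theta> X eps) \<theta>1 n \<omega> \<notin> {-1/4..1/4}}"
    unfolding s_def by (rule finite_subset) simp
qed

lemma AE_estimate_converges:
  "AE \<omega> in M. (\<lambda>n. estimate n \<omega>) \<longlonglongrightarrow> \<theta> \<and>
    finite {n. n \<ge> 1 \<and> prestep K \<alpha> (sgn (fourier1 f)) X (Yreg f \<theta> X eps) \<theta>1 n \<omega> \<notin> {-1/4..1/4}}"
proof -
  have "AE \<omega> in M. \<forall>n. X n \<omega> \<in> {-1/2..1/2}"
    by (subst AE_all_countable) (intro allI AE_X_range)
  with AE_ghat_consistent AE_design_noise_convergent AE_error_noise_convergent show ?thesis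
  proof eventually_elim
    case (elim \<omega>)
    then show ?case by (intro conjI estimate_converges) auto
  qed
qed

end

section \<open>Deriving the constants from the model assumptions\<close>

lemma (in prob_space) indep_vars_reindex_inj:
  fixes W :: "'i \<Rightarrow> 'a \<Rightarrow> 'b"
  assumes indep: "indep_vars (\<lambda>_. N) W UNIV" and inj: "inj t"
  shows "indep_vars (\<lambda>_. N) (\<lambda>n. W (t n)) UNIV"
proof -
  have "indep_vars (\<lambda>n. PiM {t n} (\<lambda>_. N)) (\<lambda>n \<omega>. restrict (\<lambda>i. W i \<omega>) {t n}) UNIV"
    using inj by (intro indep_vars_restrict[OF indep]) (auto simp: disjoint_family_on_def inj_def)
  then have "indep_vars (\<lambda>_. N) (\<lambda>n \<omega>. (\<lambda>q. q (t n)) (restrict (\<lambda>i. W i \<omega>) {t n})) UNIV"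
    by (rule indep_vars_compose2) simp
  then show ?thesis by simp
qed

theorem theorem2p1:
  fixes M :: "'a measure"
    and X eps :: "nat \<Rightarrow> 'a \<Rightarrow> real"
    and f g g' g'' K :: "real \<Rightarrow> real"
    and \<theta> \<theta>1 \<alpha> :: real
  assumes prob: "prob_space M"
    and indep: "prob_space.indep_vars M (\<lambda>_. borel)
                  (\<lambda>i. case i of Inl n \<Rightarrow> X n | Inr n \<Rightarrow> eps n) (UNIV :: (nat + nat) set)"
    and X_id: "\<And>n. distr M borel (X n) = distr M borel (X 0)"
    and eps_id: "\<And>n. distr M borel (eps n) = distr M borel (eps 0)"
    and eps_sq: "integrable M (\<lambda>\<omega>. (eps 0 \<omega>)\<^sup>2)"
    and eps_mean: "prob_space.expectation M (eps 0) = 0"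
    and eps_var: "prob_space.variance M (eps 0) > 0"
    and X_dens: "\<And>n. distributed M lborel (X n) (\<lambda>x. ennreal (g x))"
    and g_pos: "\<And>x. x \<in> {-1/2..1/2} \<Longrightarrow> g x > 0"
    and g_zero: "\<And>x. x \<notin> {-1/2..1/2} \<Longrightarrow> g x = 0"
    and g_cont: "continuous_on {-1/2..1/2} g"
    and g_d1: "\<And>x. x \<in> {-1/2..1/2} \<Longrightarrow> (g has_real_derivative g' x) (at x within {-1/2..1/2})"
    and g_d2: "\<And>x. x \<in> {-1/2..1/2} \<Longrightarrow> (g' has_real_derivative g'' x) (at x within {-1/2..1/2})"
    and g_bdd: "\<exists>B. \<forall>x\<in>{-1/2..1/2}. \<bar>g' x\<bar> \<le> B \<and> \<bar>g'' x\<bar> \<le> B"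
    and f_meas: "f \<in> borel_measurable borel"
    and f_even: "\<And>x. f (- x) = f x"
    and f_bdd: "\<exists>B. \<forall>x. \<bar>f x\<bar> \<le> B"
    and f_per: "\<And>x. f (x + 1) = f x"
    and f1_nz: "fourier1 f \<noteq> 0"
    and K_sym: "\<And>x. K (- x) = K x"
    and K_pos: "\<And>x. K x \<ge> 0"
    and K_lip: "\<exists>L. \<forall>x y. \<bar>K x - K y\<bar> \<le> L * \<bar>x - y\<bar>"
    and K_supp: "\<exists>R. \<forall>x. \<bar>x\<bar> > R \<longrightarrow> K x = 0"
    and K_int: "integrable lborel K" "integral\<^sup>L lborel K = 1"
    and K_sq: "integrable lborel (\<lambda>x. (K x)\<^sup>2)"
    and K_mom: "integrable lborel (\<lambda>x. x\<^sup>2 * K x)"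
    and alpha: "0 < \<alpha>" "\<alpha> < 1"
    and theta1: "\<theta>1 \<in> {-1/4..1/4}"
    and theta: "\<bar>\<theta>\<bar> < 1/4"
  shows "(AE \<omega> in M. (\<lambda>n. thetahat K \<alpha> (sgn (fourier1 f)) X (Yreg f \<theta> X eps) \<theta>1 n \<omega>)
                        \<longlonglongrightarrow> \<theta>)
       \<and> (AE \<omega> in M. finite {n. n \<ge> 1 \<and>
              prestep K \<alpha> (sgn (fourier1 f)) X (Yreg f \<theta> X eps) \<theta>1 n \<omega> \<notin> {-1/4..1/4}})"
proof -
  interpret prob_space M by (rule prob)
  have g_nonneg: "0 \<le> g x" for x using g_pos[of x] g_zero[of x] by (cases "x \<in> {-1/2..1/2}") auto
  obtain c where c: "0 < c" "\<And>x. x \<in> {-1/2..1/2} \<Longrightarrow> c \<le> g x"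
  proof -
    obtain x0 where "x0 \<in> {-1/2..1/2}" "\<forall>x\<in>{-1/2..1/2}. g x0 \<le> g x"
      using continuous_attains_inf[OF compact_Icc _ g_cont] by auto
    then show ?thesis using g_pos by (intro that[of "g x0"]) blast+
  qed
  obtain G where G: "\<And>x. g x \<le> G"
  proof -
    obtain x0 where x0: "x0 \<in> {-1/2..1/2}" "\<forall>x\<in>{-1/2..1/2}. g x \<le> g x0"
      using continuous_attains_sup[OF compact_Icc _ g_cont] by auto
    then have "g x \<le> g x0" for x
      using g_zero[of x] g_nonneg[of x0] by (cases "x \<in> {-1/2..1/2}") auto
    then show ?thesis by (rule that)
  qed
  obtain F where F: "\<And>x. \<bar>f x\<bar> \<le> F" using f_bdd by blast
  obtain L where L: "\<And>x y. \<bar>K x - K y\<bar> \<le> L * \<bar>x - y\<bar>" using K_lip by blast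
  obtain R0 where R0: "\<And>x. R0 < \<bar>x\<bar> \<Longrightarrow> K x = 0" using K_supp by blast
  define R where "R = max R0 1"
  have R: "0 < R" "\<And>x. R < \<bar>x\<bar> \<Longrightarrow> K x = 0" using R0 by (auto simp: R_def)
  \<comment> \<open>On the support K differs from K 0 by at most L R; adding 1 makes the bound
    strictly positive.\<close>
  define \<kappa> where "\<kappa> = K 0 + L * R + 1"
  have L0: "0 \<le> L" using order_trans[OF abs_ge_zero L[of 1 0]] by simp
  have K0: "0 \<le> K 0 + L * R" using K_pos[of 0] L0 R(1) by simp
  have \<kappa>: "K x \<le> \<kappa>" for x
  proof (cases "R < \<bar>x\<bar>")
    case False
    then have "L * \<bar>x\<bar> \<le> L * R" using L0 by (intro mult_left_mono) auto
    then show ?thesis using L[of x 0] by (simp add: \<kappa>_def)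
  qed (use R K0 in \<open>simp add: \<kappa>_def\<close>)
  have eps_meas [measurable]: "eps n \<in> borel_measurable M" for n
    using indep unfolding indep_vars_def by (metis (no_types, lifting) UNIV_I sum.case(2))
  \<comment> \<open>Equality of laws carries the moment assumptions from \<open>eps 0\<close> to
    every \<open>eps n\<close>.\<close>
  have transfer: "integrable M (\<lambda>\<omega>. h (eps n \<omega>)) = integrable M (\<lambda>\<omega>. h (eps 0 \<omega>))"
      "expectation (\<lambda>\<omega>. h (eps n \<omega>)) = expectation (\<lambda>\<omega>. h (eps 0 \<omega>))"
    if [measurable]: "h \<in> borel_measurable borel" for h :: "real \<Rightarrow> real" and n
  proof -
    show "integrable M (\<lambda>\<omega>. h (eps n \<omega>)) = integrable M (\<lambda>\<omega>. h (eps 0 \<omega>))"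
      using integrable_distr_eq[of "eps n" M borel h] integrable_distr_eq[of "eps 0" M borel h]
      by (simp add: eps_id[of n])
    show "expectation (\<lambda>\<omega>. h (eps n \<omega>)) = expectation (\<lambda>\<omega>. h (eps 0 \<omega>))"
      using integral_distr[of "eps n" M borel h] integral_distr[of "eps 0" M borel h]
      by (simp add: eps_id[of n])
  qed
  interpret projected_regression M X g K \<alpha> c G \<kappa> L R eps f \<theta> \<theta>1 F "expectation (\<lambda>\<omega>. (eps 0 \<omega>)\<^sup>2)"
  proof unfold_locales
    show "indep_vars (\<lambda>_. borel) X UNIV"
      using indep_vars_reindex_inj[OF indep, of Inl] by simp
    show "isCont g x" if "x \<in> {-1/2<..<1/2}" for x
      using continuous_on_interior[OF g_cont, of x] that by simp
    show "0 < \<kappa>" using K0 by (simp add: \<kappa>_def)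
    show "integrable M (\<lambda>\<omega>. (eps n \<omega>)\<^sup>2)" for n
      using transfer(1)[of "\<lambda>x. x\<^sup>2" n] eps_sq by simp
    show "expectation (\<lambda>\<omega>. (eps n \<omega>)\<^sup>2) \<le> expectation (\<lambda>\<omega>. (eps 0 \<omega>)\<^sup>2)" for n
      using transfer(2)[of "\<lambda>x. x\<^sup>2" n] by simp
    show "expectation (eps n) = 0" for n
      using transfer(2)[of "\<lambda>x. x" n] eps_mean by simp
  qed (rule indep X_dens c g_nonneg G K_pos \<kappa> L K_sym R K_int alpha g_zero f_meas F f_even f_per f1_nz theta1 theta; assumption?)+
  show ?thesis using AE_estimate_converges by (simp only: AE_conj_iff)
qed

end
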